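(* Let $\Omega\subset\mathbb{R}^n$ be an open set and let $\varphi:[0,\infty)\to[0,\infty)$ be a strictly convex function with $\varphi(0)=0$. Let $b_h,b\in W^{1,1}_{\rm loc}(\Omega;\mathbb{R}^m)$ be such that $b_h\to b$ in $L^1_{\rm loc}(\Omega;\mathbb{R}^m)$ as $h\to\infty$ and $$\int_\Omega\varphi(|Db_h|)\,\mathrm{d}x\to\int_\Omega\varphi(|Db|)\,\mathrm{d}x<\infty .$$ Then $$\int_\Omega\varphi\left(\frac{|Db_h-Db|}{2}\right)\mathrm{d}x\to0\qquad\text{as }h\to\infty.$$
   Context: $Db$ denotes the weak derivative (Jacobian matrix) of $b$, an $m\times n$ matrix identified with an element of $\mathbb{R}^{nm}$, and $|\cdot|$ is the Euclidean norm. *)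

theory Defs
  imports "HOL-Analysis.Analysis"
begin

definition strictly_convex_on :: "'a::real_vector set \<Rightarrow> ('a \<Rightarrow> real) \<Rightarrow> bool" where
  "strictly_convex_on S f \<longleftrightarrow> convex S \<and>
     (\<forall>x\<in>S. \<forall>y\<in>S. \<forall>t. x \<noteq> y \<and> 0 < t \<and> t < 1 \<longrightarrow>
        f ((1 - t) *\<^sub>R x + t *\<^sub>R y) < (1 - t) * f x + t * f y)"

definition partial_deriv :: "'n \<Rightarrow> (real^'n \<Rightarrow> real) \<Rightarrow> real^'n \<Rightarrow> real" where
  "partial_deriv j f x = frechet_derivative f (at x) (axis j 1)"

primrec C_k :: "nat \<Rightarrow> (real^'n \<Rightarrow> real) \<Rightarrow> bool" where
  "C_k 0 f \<longleftrightarrow> continuous_on UNIV f"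
| "C_k (Suc k) f \<longleftrightarrow> f differentiable_on UNIV \<and> (\<forall>j. C_k k (partial_deriv j f))"

(* C_c^infinity(U); its elements are regarded as extended by zero to the whole space. *)
definition test_functions :: "(real^'n) set \<Rightarrow> (real^'n \<Rightarrow> real) set" where
  "test_functions U = {\<psi>. (\<forall>k. C_k k \<psi>) \<and>
     compact (closure {x. \<psi> x \<noteq> 0}) \<and> closure {x. \<psi> x \<noteq> 0} \<subseteq> U}"

(* Functions are total; here and below, only their values on U matter. *)
definition L1_loc :: "(real^'n) set \<Rightarrow> (real^'n \<Rightarrow> 'b::euclidean_space) set" where
  "L1_loc U = {u. \<forall>K. compact K \<and> K \<subseteq> U \<longrightarrow> set_integrable lebesgue K u}"

definition tendsto_L1_loc ::
  "(real^'n) set \<Rightarrow> (nat \<Rightarrow> real^'n \<Rightarrow> 'b::euclidean_space) \<Rightarrow> (real^'n \<Rightarrow> 'b) \<Rightarrow> bool" where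
  "tendsto_L1_loc U u v \<longleftrightarrow>
     (\<forall>K. compact K \<and> K \<subseteq> U \<longrightarrow>
        (\<lambda>h. LINT x:K|lebesgue. norm (u h x - v x)) \<longlonglongrightarrow> 0)"

(* D x $ i $ j is the weak derivative of the i-th component in direction j. The norm on
   real^'n^'m is the Euclidean norm of all entries (not an operator norm). *)
definition has_weak_derivative ::
  "(real^'n) set \<Rightarrow> (real^'n \<Rightarrow> real^'m) \<Rightarrow> (real^'n \<Rightarrow> real^'n^'m) \<Rightarrow> bool" where
  "has_weak_derivative U u D \<longleftrightarrow> u \<in> L1_loc U \<and> D \<in> L1_loc U \<and>
     (\<forall>\<psi>\<in>test_functions U. \<forall>i j.
        (LINT x:U|lebesgue. u x $ i * partial_deriv j \<psi> x)
          = - (LINT x:U|lebesgue. D x $ i $ j * \<psi> x))"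

definition W11_loc :: "(real^'n) set \<Rightarrow> (real^'n \<Rightarrow> real^'m) set" where
  "W11_loc U = {u. \<exists>D. has_weak_derivative U u D}"

end

theory Submission
  imports Defs
begin

text \<open>Write \<open>\<Phi> X = \<phi> \<bar>X\<bar>\<close>. The \<open>L\<^sup>1\<close> convergence of \<open>b\<^sub>h\<close> gives \<open>\<integral> \<psi> Db\<^sub>h \<longlonglongrightarrow> \<integral> \<psi> Db\<close> for smooth bumps \<open>\<psi>\<close>, and
  this alone implies \<open>\<integral> \<Phi>(Db) \<le> liminf \<integral> \<Phi>(Db\<^sub>h)\<close>: bound \<open>\<Phi>\<close> below by affine functions whose coefficients vary
  with the point, first constant on disjoint balls (Vitali), then continuous, then measurable.
  Lower semicontinuity along the midpoints \<open>(Db\<^sub>h + Db) / 2\<close> forces the nonnegative convexity gap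
  \<open>(\<Phi>(Db\<^sub>h) + \<Phi>(Db)) / 2 - \<Phi>((Db\<^sub>h + Db) / 2)\<close> to tend to 0 in \<open>L\<^sup>1\<close>, hence almost everywhere along a subsequence.
  The gap to a fixed point is positive away from it and nondecreasing along rays, so \<open>Db\<^sub>h \<longlonglongrightarrow> Db\<close> almost
  everywhere along that subsequence. Fatou's lemma for
  \<open>(\<Phi>(Db\<^sub>h) + \<Phi>(Db)) / 2 - \<Phi>((Db\<^sub>h - Db) / 2) \<ge> 0\<close> concludes.\<close>

section \<open>Smooth bumps\<close>

text \<open>\<open>flat 1 0\<close> is the classical smooth function exp(-1/t) that is flat at 0.
  The power \<open>t ^ k\<close> closes the family under differentiation up to linear combinations;
  \<open>d\<close> is kept free because d \<rightarrow> 0 turns \<open>flat d 0\<close> into the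
  indicator of the positive half-line.\<close>

definition flat :: "real \<Rightarrow> nat \<Rightarrow> real \<Rightarrow> real" where
  "flat d k t = (if t \<le> 0 then 0 else exp (- d / t) / t ^ k)"

text \<open>A single term of the exponential series at \<open>d / t\<close>, the one of order
  \<open>k + 2\<close>, already dominates. The two orders beyond \<open>k\<close> leave a factor
  \<open>t\<^sup>2\<close>, enough for a zero derivative at 0.\<close>

lemma flat_le_square:
  assumes "0 < d"
  shows "\<bar>flat d k t\<bar> \<le> fact (k + 2) / d ^ (k + 2) * t\<^sup>2"
proof (cases "t \<le> 0")
  case False
  then have t: "0 < t" by simp
  have "(d / t) ^ (k + 2) / fact (k + 2) \<le> (\<Sum>n\<in>{k+2}. (d / t) ^ n /\<^sub>R fact n)"
    by (simp add: divide_inverse mult.commute del: fact_Suc)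
  also have "\<dots> \<le> exp (d / t)"
    unfolding exp_def
    by (rule sum_le_suminf) (use t assms summable_exp_generic[of "d / t"] in auto)
  finally have "(d / t) ^ (k + 2) / fact (k + 2) \<le> exp (d / t)" .
  moreover have "(d / t) ^ (k + 2) = d ^ (k + 2) / (t ^ k * t\<^sup>2)"
    by (simp add: power_divide power_add power2_eq_square del: fact_Suc)
  ultimately have "d ^ (k + 2) / (t ^ k * t\<^sup>2) / fact (k + 2) \<le> exp (d / t)"
    by metis
  moreover have "a / (b * s) / F \<le> E \<Longrightarrow> inverse E / b \<le> F / a * s"
    if "0 < a" "0 < b" "0 < s" "0 < F" "0 < E" for a b s F E :: real
    using that by (simp add: field_simps)
  ultimately have "inverse (exp (d / t)) / t ^ k \<le> fact (k + 2) / d ^ (k + 2) * t\<^sup>2"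
    using t assms by (metis exp_gt_zero fact_gt_zero zero_less_power)
  then have "exp (- d / t) / t ^ k \<le> fact (k + 2) / d ^ (k + 2) * t\<^sup>2"
    by (simp only: exp_minus[symmetric] minus_divide_left)
  with t show ?thesis by (simp add: flat_def)
qed (use assms in \<open>simp add: flat_def\<close>)

lemma DERIV_flat:
  assumes "0 < d"
  shows "DERIV (flat d k) t :> d * flat d (k + 2) t - real k * flat d (k + 1) t"
proof -
  consider "t < 0" | "t = 0" | "0 < t" by linarith
  then show ?thesis
  proof cases
    case 1
    have "DERIV (\<lambda>_. 0) t :> 0" by simp
    then have "DERIV (flat d k) t :> 0"
      by (rule has_field_derivative_transform_within_open[where S="{..<0}"])
         (use 1 in \<open>auto simp: flat_def\<close>)
    with 1 show ?thesis by (simp add: flat_def)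
  next
    case 2
    \<comment> \<open>At 0 the claimed derivative is 0, since every \<open>flat d j\<close> vanishes
      there, and the quadratic bound makes the difference quotient at most a constant times
      \<open>\<bar>h\<bar>\<close>.\<close>
    have "((\<lambda>h. flat d k h / h) \<longlongrightarrow> 0) (at 0)"
    proof (rule Lim_null_comparison)
      let ?C = "fact (k + 2) / d ^ (k + 2)"
      have "norm (flat d k h / h) \<le> ?C * \<bar>h\<bar>" if "h \<noteq> 0" for h
      proof -
        have "norm (flat d k h / h) = \<bar>flat d k h\<bar> / \<bar>h\<bar>" by simp
        also have "\<dots> \<le> ?C * h\<^sup>2 / \<bar>h\<bar>"
          by (intro divide_right_mono flat_le_square assms) simp
        also have "\<dots> = ?C * \<bar>h\<bar>"
          using that by (simp add: power2_eq_square abs_if)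
        finally show ?thesis .
      qed
      then show "\<forall>\<^sub>F h in at 0. norm (flat d k h / h) \<le> ?C * \<bar>h\<bar>"
        by (auto simp: eventually_at_filter)
      show "((\<lambda>h. ?C * \<bar>h\<bar>) \<longlongrightarrow> 0) (at 0)"
        by (intro tendsto_mult_right_zero tendsto_rabs_zero tendsto_ident_at)
    qed
    moreover have "flat d j 0 = 0" for j
      by (simp add: flat_def)
    ultimately show ?thesis using 2 by (simp add: DERIV_def)
  next
    case 3
    have "DERIV (\<lambda>t. exp (- d / t) / t ^ k) t :> d * flat d (k + 2) t - real k * flat d (k + 1) t"
    proof -
      have "DERIV (\<lambda>t. - d / t) t :> d / t\<^sup>2"
        using 3 by (auto intro!: derivative_eq_intros simp: power2_eq_square)
      from DERIV_divide[OF DERIV_fun_exp[OF this] DERIV_pow[of k]]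
      have "DERIV (\<lambda>t. exp (- d / t) / t ^ k) t :>
          (exp (- d / t) * (d / t\<^sup>2) * t ^ k - exp (- d / t) * (real k * t ^ (k - Suc 0))) / (t ^ k * t ^ k)"
        using 3 by simp
      moreover have "(E * (d / t\<^sup>2) * t ^ k - E * (real k * t ^ (k - Suc 0))) / (t ^ k * t ^ k)
          = d * (E / t ^ (k + 2)) - real k * (E / t ^ (k + 1))" for E
        using 3 by (cases k) (simp_all add: field_simps power2_eq_square)
      ultimately show ?thesis using 3 by (simp add: flat_def)
    qed
    then show ?thesis
      by (rule has_field_derivative_transform_within_open[where S="{0<..}"])
         (use 3 in \<open>auto simp: flat_def\<close>)
  qed
qed

text \<open>The squared norm keeps the function smooth at the center \<open>c\<close>.\<close>

definition bump :: "real \<Rightarrow> 'a::euclidean_space \<Rightarrow> real \<Rightarrow> 'a \<Rightarrow> real" where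
  "bump d c r x = flat d 0 (r\<^sup>2 - (norm (x - c))\<^sup>2)"

lemma bump_nonneg: "0 \<le> bump d c r x"
  by (simp add: bump_def flat_def)

lemma bump_le_1: "0 < d \<Longrightarrow> bump d c r x \<le> 1"
  by (simp add: bump_def flat_def divide_nonneg_pos)

lemma bump_eq_0_iff: "0 < r \<Longrightarrow> bump d c r x = 0 \<longleftrightarrow> x \<notin> ball c r"
  using power2_le_iff_abs_le[of "norm (x - c)" r] power_mono_iff[of r "norm (x - c)" 2]
  by (auto simp: bump_def flat_def dist_norm norm_minus_commute not_less)

lemma continuous_bump: "0 < d \<Longrightarrow> continuous_on S (bump d c r)"
  unfolding bump_def
  by (rule continuous_on_compose2[of UNIV "flat d 0"])
     (auto intro!: continuous_intros DERIV_continuous_on[OF has_field_derivative_at_within[OF DERIV_flat]])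

text \<open>Inside the ball the argument t of \<open>flat\<close> is a fixed positive number and
  exp(-d/t) tends to 1 as d tends to 0; outside, every bump vanishes. This is how indicators of
  balls are reached from test functions.\<close>

lemma bump_tendsto_indicator:
  assumes "0 < r"
  shows "(\<lambda>n. bump (1 / Suc n) c r x) \<longlonglongrightarrow> indicator (ball c r) x"
proof (cases "x \<in> ball c r")
  case True
  then have "0 < r\<^sup>2 - (norm (x - c))\<^sup>2"
    using assms by (simp add: dist_norm norm_minus_commute power_strict_mono)
  moreover have "(\<lambda>n. exp (- (1 / real (Suc n)) / t)) \<longlonglongrightarrow> 1" if "0 < t" for t :: real
  proof -
    have "(\<lambda>n. exp (- (1 / real (Suc n)) / t)) \<longlonglongrightarrow> exp (- 0 / t)"
      by (intro tendsto_intros LIMSEQ_Suc[OF lim_1_over_n] that) (use that in auto)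
    then show ?thesis by simp
  qed
  ultimately show ?thesis using True by (simp add: bump_def flat_def)
next
  case False
  with assms bump_eq_0_iff[of r _ c x] show ?thesis by simp
qed

text \<open>A class of functions that contains the bumps and is closed under partial derivatives, which gives
  smoothness of the bumps by induction on the order.\<close>

inductive bumpy :: "real \<Rightarrow> real^'n \<Rightarrow> real \<Rightarrow> (real^'n \<Rightarrow> real) \<Rightarrow> bool" for d c r where
  flat: "bumpy d c r (\<lambda>x. flat d k (r\<^sup>2 - (norm (x - c))\<^sup>2))"
| scale: "bumpy d c r f \<Longrightarrow> bumpy d c r (\<lambda>x. a * f x)"
| coord: "bumpy d c r f \<Longrightarrow> bumpy d c r (\<lambda>x. (x - c) $ i * f x)"
| add: "bumpy d c r f \<Longrightarrow> bumpy d c r g \<Longrightarrow> bumpy d c r (\<lambda>x. f x + g x)"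

lemma bumpy_eq_0:
  "bumpy d c r f \<Longrightarrow> 0 < r \<Longrightarrow> x \<notin> ball c r \<Longrightarrow> f x = 0"
  by (induction rule: bumpy.induct)
     (auto simp: flat_def dist_norm norm_minus_commute not_less power_mono)

text \<open>The induction carries the whole Frechet derivative, because \<open>partial_deriv\<close>
  is informative only once differentiability is known. The chain, sum and product rules each return
  expressions built by the four formation rules.\<close>

lemma bumpy_has_derivative:
  assumes "bumpy d c r f" and "0 < d"
  shows "\<exists>f'. (\<forall>j. bumpy d c r (f' j)) \<and>
    (\<forall>x. (f has_derivative (\<lambda>v. \<Sum>j\<in>UNIV. v $ j * f' j x)) (at x))"
  using assms(1)
proof induction
  case (flat k)
  let ?t = "\<lambda>x. r\<^sup>2 - (norm (x - c))\<^sup>2"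
  \<comment> \<open>The factor -2 and the coordinate come from differentiating \<open>?t\<close>.
    The difference in \<open>DERIV_flat\<close> is written as a sum with scalar
    \<open>- real k\<close> so that the rules of \<open>bumpy\<close> apply syntactically.\<close>
  let ?f' = "\<lambda>j x. (-2) * ((x - c) $ j * (d * flat d (k + 2) (?t x) + (- real k) * flat d (k + 1) (?t x)))"
  have "((\<lambda>x. flat d k (?t x)) has_derivative (\<lambda>v. \<Sum>j\<in>UNIV. v $ j * ?f' j x)) (at x)" for x
  proof -
    have q: "(?t has_derivative (\<lambda>v. - 2 * ((x - c) \<bullet> v))) (at x)"
      unfolding power2_norm_eq_inner
      by (auto intro!: derivative_eq_intros simp: inner_commute)
    have "((\<lambda>x. flat d k (?t x)) has_derivative
        (\<lambda>v. (d * flat d (k + 2) (?t x) - real k * flat d (k + 1) (?t x)) * (- 2 * ((x - c) \<bullet> v)))) (at x)"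
      using has_derivative_compose[OF q DERIV_flat[OF assms(2), unfolded has_field_derivative_def]] .
    moreover have "(\<lambda>v. (d * flat d (k + 2) (?t x) - real k * flat d (k + 1) (?t x)) * (- 2 * ((x - c) \<bullet> v)))
        = (\<lambda>v. \<Sum>j\<in>UNIV. v $ j * ?f' j x)"
      by (intro ext) (simp only: inner_vec_def sum_distrib_left, intro sum.cong,
          simp_all add: algebra_simps)
    ultimately show ?thesis by simp
  qed
  then show ?case
    by (intro exI[of _ ?f'] conjI allI bumpy.intros)
next
  case (scale f a)
  then obtain f' where f': "\<And>j. bumpy d c r (f' j)"
    "\<And>x. (f has_derivative (\<lambda>v. \<Sum>j\<in>UNIV. v $ j * f' j x)) (at x)" by blast
  have "((\<lambda>x. a * f x) has_derivative (\<lambda>v. \<Sum>j\<in>UNIV. v $ j * (a * f' j x))) (at x)" for x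
    by (rule derivative_eq_intros f'(2))+ (simp add: sum_distrib_left algebra_simps)
  then show ?case
    by (intro exI[of _ "\<lambda>j x. a * f' j x"] conjI allI bumpy.intros f')
next
  case (coord f i)
  then obtain f' where f': "\<And>j. bumpy d c r (f' j)"
    "\<And>x. (f has_derivative (\<lambda>v. \<Sum>j\<in>UNIV. v $ j * f' j x)) (at x)" by blast
  \<comment> \<open>Product rule; the Kronecker delta is the derivative of the coordinate and counts
    as a scalar factor for \<open>bumpy.scale\<close>.\<close>
  let ?g = "\<lambda>j x. (if j = i then 1 else 0) * f x + (x - c) $ i * f' j x"
  have "((\<lambda>x. (x - c) $ i * f x) has_derivative (\<lambda>v. \<Sum>j\<in>UNIV. v $ j * ?g j x)) (at x)" for x
  proof -
    have 1: "((\<lambda>x. (x - c) $ i) has_derivative (\<lambda>v. v $ i)) (at x)"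
      by (auto intro!: derivative_eq_intros bounded_linear.has_derivative[OF bounded_linear_vec_nth])
    have 2: "(\<Sum>j\<in>UNIV. v $ j * ?g j x) = (x - c) $ i * (\<Sum>j\<in>UNIV. v $ j * f' j x) + v $ i * f x" for v
    proof -
      have "(\<Sum>j\<in>UNIV. v $ j * ?g j x) = (\<Sum>j\<in>UNIV. (if j = i then v $ j * f x else 0) + (x - c) $ i * (v $ j * f' j x))"
        by (intro sum.cong) (auto simp: algebra_simps)
      then show ?thesis by (simp only: sum.distrib sum_distrib_left sum.delta finite) simp
    qed
    show ?thesis unfolding 2 by (rule has_derivative_mult[OF 1 f'(2)])
  qed
  then show ?case
    by (intro exI[of _ ?g] conjI allI bumpy.intros f' coord)
next
  case (add f g)
  then obtain f' g' where f': "\<And>j. bumpy d c r (f' j)"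
    "\<And>x. (f has_derivative (\<lambda>v. \<Sum>j\<in>UNIV. v $ j * f' j x)) (at x)"
    and g': "\<And>j. bumpy d c r (g' j)"
    "\<And>x. (g has_derivative (\<lambda>v. \<Sum>j\<in>UNIV. v $ j * g' j x)) (at x)" by blast
  have "((\<lambda>x. f x + g x) has_derivative (\<lambda>v. \<Sum>j\<in>UNIV. v $ j * (f' j x + g' j x))) (at x)" for x
    by (rule derivative_eq_intros f'(2) g'(2))+ (simp add: sum.distrib algebra_simps)
  then show ?case
    by (intro exI[of _ "\<lambda>j x. f' j x + g' j x"] conjI allI bumpy.intros f' g')
qed

lemma
  assumes "bumpy d c r f" and "0 < d"
  shows bumpy_differentiable: "f differentiable (at x)"
    and bumpy_partial_deriv: "bumpy d c r (partial_deriv j f)"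
proof -
  obtain f' where f': "\<And>j. bumpy d c r (f' j)"
    "\<And>x. (f has_derivative (\<lambda>v. \<Sum>j\<in>UNIV. v $ j * f' j x)) (at x)"
    using bumpy_has_derivative[OF assms] by blast
  show "f differentiable (at x)"
    using f'(2) by (auto simp: differentiable_def)
  have "partial_deriv j f x = f' j x" for x
  proof -
    have "frechet_derivative f (at x) = (\<lambda>v. \<Sum>j\<in>UNIV. v $ j * f' j x)"
      using frechet_derivative_at[OF f'(2)] by simp
    then have "partial_deriv j f x = (\<Sum>i\<in>UNIV. if i = j then f' i x else 0)"
      unfolding partial_deriv_def by (simp only:, intro sum.cong) (auto simp: axis_def)
    then show ?thesis by simp
  qed
  then have "partial_deriv j f = f' j" by blast
  then show "bumpy d c r (partial_deriv j f)" using f'(1) by simp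
qed

lemma bumpy_continuous: "bumpy d c r f \<Longrightarrow> 0 < d \<Longrightarrow> continuous_on S f"
  by (meson bumpy_differentiable continuous_at_imp_continuous_on differentiable_imp_continuous_within)

lemma bumpy_C_k:
  assumes "0 < d"
  shows "bumpy d c r f \<Longrightarrow> C_k k f"
  by (induction k arbitrary: f)
     (auto intro: bumpy_continuous[OF _ assms] bumpy_partial_deriv[OF _ assms]
        differentiable_at_withinI bumpy_differentiable[OF _ assms] simp: differentiable_on_def)

lemma bumpy_bump: "bumpy d c r (bump d c r)"
  using bumpy.flat[of d c r 0] by (simp add: bump_def[abs_def])

text \<open>The support is the closure of the open ball, so it is the closed ball that has to lie in
  \<open>U\<close>.\<close>

lemma bump_test_function:
  assumes "0 < d" "0 < r" "cball c r \<subseteq> U"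
  shows "bump d c r \<in> test_functions U"
proof -
  have "{x. bump d c r x \<noteq> 0} = ball c r"
    using bump_eq_0_iff[OF assms(2)] by blast
  then show ?thesis
    using assms bumpy_C_k[OF assms(1) bumpy_bump[of d c r]] by (simp add: test_functions_def)
qed

section \<open>Lower semicontinuity\<close>

lemma bump_measurable: "0 < d \<Longrightarrow> bump d c r \<in> borel_measurable lebesgue"
  using continuous_imp_measurable_on_sets_lebesgue[OF continuous_bump, of d UNIV c r]
  by (simp add: lebesgue_on_UNIV_eq)

lemma bump_le_indicator:
  "0 < r \<Longrightarrow> 0 < d \<Longrightarrow> bump d c r x \<le> indicator (cball c r) x"
  using bump_le_1[of d c r x] bump_eq_0_iff[of r d c x]
  by (auto simp: indicator_def)

text \<open>\<open>ennreal\<close> sends negative values to 0, so the right-hand side integrates the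
  positive part of \<open>f\<close>.\<close>

lemma ennreal_integral_le_nn_integral:
  assumes "integrable M f"
  shows "ennreal (integral\<^sup>L M f) \<le> (\<integral>\<^sup>+x. ennreal (f x) \<partial>M)"
proof -
  have "ennreal (integral\<^sup>L M f) \<le> ennreal (\<integral>x. max 0 (f x) \<partial>M)"
    using assms by (intro ennreal_leI integral_mono) auto
  also have "\<dots> = (\<integral>\<^sup>+x. ennreal (max 0 (f x)) \<partial>M)"
    using assms by (intro nn_integral_eq_integral[symmetric]) auto
  also have "\<dots> = (\<integral>\<^sup>+x. ennreal (f x) \<partial>M)"
    by (intro nn_integral_cong) (simp add: ennreal_max_0)
  finally show ?thesis .
qed

lemma bump_scaleR_integrable:
  fixes C :: "'a::euclidean_space \<Rightarrow> 'b::euclidean_space"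
  assumes "C \<in> borel_measurable lebesgue" "set_integrable lebesgue (cball c r) C" "0 < d" "0 < r"
  shows "integrable lebesgue (\<lambda>x. bump d c r x *\<^sub>R C x)"
proof (rule Bochner_Integration.integrable_bound)
  show "integrable lebesgue (\<lambda>x. indicator (cball c r) x *\<^sub>R C x)"
    using assms(2) by (simp add: set_integrable_def)
  show "(\<lambda>x. bump d c r x *\<^sub>R C x) \<in> borel_measurable lebesgue"
    using assms bump_measurable by measurable
  show "AE x in lebesgue. norm (bump d c r x *\<^sub>R C x) \<le> norm (indicator (cball c r) x *\<^sub>R C x)"
    using bump_le_indicator[OF assms(4,3), of c] bump_nonneg[of d c r]
    by (intro AE_I2) (simp add: mult_right_mono)
qed

lemma bump_integrable:
  fixes c :: "'a::euclidean_space"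
  assumes "0 < d" "0 < r"
  shows "integrable lebesgue (bump d c r)"
proof (rule Bochner_Integration.integrable_bound)
  show "integrable lebesgue (indicator (cball c r) :: 'a \<Rightarrow> real)"
    using emeasure_bounded_finite[OF bounded_cball, of c r] by (intro integrable_real_indicator) auto
  show "AE x in lebesgue. norm (bump d c r x) \<le> norm (indicator (cball c r) x :: real)"
    using bump_le_indicator[OF assms(2,1), of c] bump_nonneg[of d c r] by (intro AE_I2) simp
qed (rule bump_measurable[OF assms(1)])

text \<open>What lower semicontinuity uses of the Sobolev setting: convergence of the fields tested
  against bumps, and convexity of the integrand in the form of subgradients. It is stated abstractly
  because it is used for the midpoint fields as well as for the derivatives themselves.\<close>

locale weak_limit =
  fixes \<Omega> :: "'a::euclidean_space set"
    and A :: "nat \<Rightarrow> 'a \<Rightarrow> 'b::euclidean_space"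
    and B :: "'a \<Rightarrow> 'b"
    and \<Phi> :: "'b \<Rightarrow> real"
  assumes open_domain: "open \<Omega>"
    and A_measurable [measurable]: "\<And>h. A h \<in> borel_measurable lebesgue"
    and B_measurable [measurable]: "B \<in> borel_measurable lebesgue"
    and A_integrable: "\<And>h K. compact K \<Longrightarrow> K \<subseteq> \<Omega> \<Longrightarrow> set_integrable lebesgue K (A h)"
    and B_integrable: "\<And>K. compact K \<Longrightarrow> K \<subseteq> \<Omega> \<Longrightarrow> set_integrable lebesgue K B"
    and weak: "\<And>c r d. 0 < r \<Longrightarrow> 0 < d \<Longrightarrow> cball c r \<subseteq> \<Omega> \<Longrightarrow>
      (\<lambda>h. \<integral>x. bump d c r x *\<^sub>R A h x \<partial>lebesgue) \<longlonglongrightarrow> (\<integral>x. bump d c r x *\<^sub>R B x \<partial>lebesgue)"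
    and subgradient: "\<And>S. \<exists>p. \<forall>X. \<Phi> S + p \<bullet> (X - S) \<le> \<Phi> X"
    and continuous: "continuous_on UNIV \<Phi>"
    and nonneg: "\<And>X. 0 \<le> \<Phi> X"
begin

text \<open>A pair \<open>(p, a)\<close> encodes the affine function \<open>X \<mapsto> p \<bullet> X + a\<close>, evaluated as \<open>(p, a) \<bullet> (X, 1)\<close>.\<close>

definition minorants :: "('b \<times> real) set" where
  "minorants = {q. \<forall>X. q \<bullet> (X, 1) \<le> \<Phi> X}"

lemma zero_minorant: "0 \<in> minorants"
  using nonneg by (simp add: minorants_def)

text \<open>Each \<open>X\<close> imposes a closed half-space condition on the pair. Convexity and
  closedness serve the nearest-point projection onto bounded minorants.\<close>

lemma convex_minorants: "convex minorants"
  unfolding minorants_def Collect_all_eq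
  by (intro convex_INT) (simp add: inner_commute[of _ "(_, _)"] convex_halfspace_le)

lemma closed_minorants: "closed minorants"
  unfolding minorants_def Collect_all_eq
  by (intro closed_INT ballI) (simp add: inner_commute[of _ "(_, _)"] closed_halfspace_le)

definition liminf_energy :: ennreal where
  "liminf_energy = liminf (\<lambda>h. \<integral>\<^sup>+x\<in>\<Omega>. ennreal (\<Phi> (A h x)) \<partial>lebesgue)"

text \<open>The lower semicontinuity inequality with \<Phi>(B) replaced by the affine functions
  \<open>P x\<close> evaluated at \<open>B x\<close>. It is proved for richer and richer fields
  \<open>P\<close> of minorants, and \<Phi>(B) is recovered at the end as their supremum. A negative
  integral satisfies it trivially, since \<open>ennreal\<close> makes it 0.\<close>

definition admissible :: "('a \<Rightarrow> 'b \<times> real) \<Rightarrow> bool" where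
  "admissible P \<longleftrightarrow> ennreal (\<integral>x. P x \<bullet> (B x, 1) \<partial>lebesgue) \<le> liminf_energy"

text \<open>For fixed coefficients the integral is affine in the bump averages of the field, so
  \<open>weak\<close> passes it to the limit. By disjointness at most one term is nonzero at each
  point; it is a minorant times a factor in [0,1], hence at most \<Phi>(A h x) because \<Phi> is
  nonnegative.\<close>

lemma admissible_bumps:
  fixes c :: "'i \<Rightarrow> 'a"
  assumes "finite F" "0 < d" and F: "\<And>j. j \<in> F \<Longrightarrow> q j \<in> minorants \<and> 0 < r j \<and> cball (c j) (r j) \<subseteq> \<Omega>"
    and disj: "pairwise (\<lambda>i j. disjnt (ball (c i) (r i)) (ball (c j) (r j))) F"
  shows "admissible (\<lambda>x. \<Sum>j\<in>F. bump d (c j) (r j) x *\<^sub>R q j)"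
proof -
  let ?b = "\<lambda>j. bump d (c j) (r j)"
  let ?P = "\<lambda>x. \<Sum>j\<in>F. ?b j x *\<^sub>R q j"
  let ?J = "\<lambda>C :: 'a \<Rightarrow> 'b. \<Sum>j\<in>F. fst (q j) \<bullet> (\<integral>x. ?b j x *\<^sub>R C x \<partial>lebesgue) + snd (q j) * (\<integral>x. ?b j x \<partial>lebesgue)"
  \<comment> \<open>Stated for a general field \<open>C\<close>, to be used for every
    \<open>A h\<close> and for \<open>B\<close>.\<close>
  have J: "integrable lebesgue (\<lambda>x. ?P x \<bullet> (C x, 1)) \<and> (\<integral>x. ?P x \<bullet> (C x, 1) \<partial>lebesgue) = ?J C"
    if C: "C \<in> borel_measurable lebesgue" "\<And>K. compact K \<Longrightarrow> K \<subseteq> \<Omega> \<Longrightarrow> set_integrable lebesgue K C"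
    for C :: "'a \<Rightarrow> 'b"
  proof -
    have eq: "?P x \<bullet> (C x, 1) = (\<Sum>j\<in>F. fst (q j) \<bullet> (?b j x *\<^sub>R C x) + snd (q j) * ?b j x)" for x
      by (simp only: inner_sum_left) (simp add: inner_prod_def algebra_simps)
    have i: "integrable lebesgue (\<lambda>x. ?b j x *\<^sub>R C x)" "integrable lebesgue (?b j)" if "j \<in> F" for j
      using F[OF that] C assms(2) by (auto intro!: bump_scaleR_integrable bump_integrable)
    have t: "integrable lebesgue (\<lambda>x. fst (q j) \<bullet> (?b j x *\<^sub>R C x))"
      "integrable lebesgue (\<lambda>x. snd (q j) * ?b j x)" if "j \<in> F" for j
      using i[OF that] by (auto intro!: integrable_inner_right integrable_mult_right simp del: inner_scaleR_right)
    have "(\<integral>x. fst (q j) \<bullet> (?b j x *\<^sub>R C x) + snd (q j) * ?b j x \<partial>lebesgue)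
        = fst (q j) \<bullet> (\<integral>x. ?b j x *\<^sub>R C x \<partial>lebesgue) + snd (q j) * (\<integral>x. ?b j x \<partial>lebesgue)" if "j \<in> F" for j
      using Bochner_Integration.integral_add[OF t[OF that]] i[OF that]
      by (simp only: integral_inner_right integral_mult_right_zero)
    moreover have "integrable lebesgue (\<lambda>x. fst (q j) \<bullet> (?b j x *\<^sub>R C x) + snd (q j) * ?b j x)" if "j \<in> F" for j
      using t[OF that] by (rule Bochner_Integration.integrable_add)
    ultimately show ?thesis
      unfolding eq by (simp add: Bochner_Integration.integral_sum Bochner_Integration.integrable_sum cong: sum.cong del: inner_scaleR_right)
  qed
  have "(\<lambda>h. ?J (A h)) \<longlonglongrightarrow> ?J B"
    using F assms(2) by (intro tendsto_intros weak) auto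
  then have "(\<lambda>h. ennreal (\<integral>x. ?P x \<bullet> (A h x, 1) \<partial>lebesgue)) \<longlonglongrightarrow> ennreal (\<integral>x. ?P x \<bullet> (B x, 1) \<partial>lebesgue)"
    using J[OF A_measurable A_integrable] J[OF B_measurable B_integrable] by (intro tendsto_ennrealI) simp
  then have "ennreal (\<integral>x. ?P x \<bullet> (B x, 1) \<partial>lebesgue) = liminf (\<lambda>h. ennreal (\<integral>x. ?P x \<bullet> (A h x, 1) \<partial>lebesgue))"
    by (intro lim_imp_Liminf[symmetric]) auto
  also have "\<dots> \<le> liminf_energy"
    unfolding liminf_energy_def
  proof (intro Liminf_mono always_eventually allI)
    fix h
    have le: "?P x \<bullet> (A h x, 1) \<le> indicator \<Omega> x * \<Phi> (A h x)" for x
    proof (cases "\<exists>j\<in>F. x \<in> ball (c j) (r j)")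
      case True
      then obtain j where j: "j \<in> F" "x \<in> ball (c j) (r j)" by blast
      have "?b i x *\<^sub>R q i = 0" if "i \<in> F - {j}" for i
        using disj j that F bump_eq_0_iff[of "r i" d "c i" x]
        by (auto simp: pairwise_def disjnt_iff)
      then have "(\<Sum>i\<in>F - {j}. ?b i x *\<^sub>R q i) = 0" by (intro sum.neutral) blast
      then have "?P x = ?b j x *\<^sub>R q j"
        using assms(1) j by (simp add: sum.remove)
      moreover have "?b j x * (q j \<bullet> (A h x, 1)) \<le> ?b j x * \<Phi> (A h x)"
        using F[OF j(1)] bump_nonneg by (intro mult_left_mono) (auto simp: minorants_def)
      moreover have "?b j x * \<Phi> (A h x) \<le> 1 * \<Phi> (A h x)"
        using bump_le_1[OF assms(2)] nonneg by (intro mult_right_mono) auto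
      moreover have "x \<in> \<Omega>" using F[OF j(1)] j(2) by auto
      ultimately show ?thesis by simp
    next
      case False
      then have "?P x = 0"
        using F bump_eq_0_iff[of "r _" d "c _" x] by (intro sum.neutral) auto
      then show ?thesis using nonneg by simp
    qed
    have "ennreal (\<integral>x. ?P x \<bullet> (A h x, 1) \<partial>lebesgue) \<le> (\<integral>\<^sup>+x. ennreal (?P x \<bullet> (A h x, 1)) \<partial>lebesgue)"
      using J[OF A_measurable A_integrable] by (intro ennreal_integral_le_nn_integral) auto
    also have "\<dots> \<le> (\<integral>\<^sup>+x\<in>\<Omega>. ennreal (\<Phi> (A h x)) \<partial>lebesgue)"
    proof (rule nn_integral_mono)
      fix x
      have "ennreal (?P x \<bullet> (A h x, 1)) \<le> ennreal (indicator \<Omega> x * \<Phi> (A h x))"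
        by (rule ennreal_leI[OF le])
      then show "ennreal (?P x \<bullet> (A h x, 1)) \<le> ennreal (\<Phi> (A h x)) * indicator \<Omega> x"
        by (cases "x \<in> \<Omega>") auto
    qed
    finally show "ennreal (\<integral>x. ?P x \<bullet> (A h x, 1) \<partial>lebesgue) \<le> (\<integral>\<^sup>+x\<in>\<Omega>. ennreal (\<Phi> (A h x)) \<partial>lebesgue)" .
  qed
  finally show ?thesis by (simp add: admissible_def)
qed

text \<open>Only the side with \<open>B\<close> depends on the field, so dominated convergence
  suffices: on \<open>K\<close> the integrands are bounded by R(|B| + 1), which is integrable, and
  off \<open>K\<close> they vanish.\<close>

lemma admissible_limit:
  assumes K: "compact K" "K \<subseteq> \<Omega>"
    and meas: "\<And>n. P n \<in> borel_measurable lebesgue" "Q \<in> borel_measurable lebesgue"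
    and bound: "\<And>n x. norm (P n x) \<le> R" "\<And>n x. x \<notin> K \<Longrightarrow> P n x = 0"
    and lim: "AE x in lebesgue. (\<lambda>n. P n x) \<longlonglongrightarrow> Q x"
    and admissible: "\<And>n. admissible (P n)"
  shows "admissible Q"
proof -
  have [measurable]: "K \<in> sets lebesgue" using compact_imp_closed[OF K(1)] by simp
  note [measurable] = meas
  have "(\<lambda>n. \<integral>x. P n x \<bullet> (B x, 1) \<partial>lebesgue) \<longlonglongrightarrow> (\<integral>x. Q x \<bullet> (B x, 1) \<partial>lebesgue)"
  proof (rule integral_dominated_convergence)
    let ?w = "\<lambda>x. R * (norm (indicator K x *\<^sub>R B x) + indicator K x)"
    have "emeasure lborel K < \<infinity>" using K by (intro emeasure_bounded_finite compact_imp_bounded)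
    then have "integrable lebesgue (indicator K :: 'a \<Rightarrow> real)"
      using K by (intro integrable_real_indicator) (auto simp: compact_imp_closed)
    then show "integrable lebesgue ?w"
      using B_integrable[OF K]
      by (intro integrable_mult_right Bochner_Integration.integrable_add integrable_norm)
         (auto simp: set_integrable_def)
    show "AE x in lebesgue. (\<lambda>n. P n x \<bullet> (B x, 1)) \<longlonglongrightarrow> Q x \<bullet> (B x, 1)"
      using lim by eventually_elim (intro tendsto_intros)
    have "norm (P n x \<bullet> (B x, 1)) \<le> ?w x" for n x
    proof (cases "x \<in> K")
      case True
      have "norm (P n x \<bullet> (B x, 1)) \<le> norm (P n x) * norm (B x, 1::real)"
        by (simp add: Cauchy_Schwarz_ineq2)
      also have "\<dots> \<le> R * (norm (B x) + norm (1::real))"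
        using bound(1)[of n x] by (intro mult_mono norm_Pair_le) (auto intro: order_trans[OF norm_ge_zero])
      finally show ?thesis using True by simp
    qed (simp add: bound)
    then show "\<And>n. AE x in lebesgue. norm (P n x \<bullet> (B x, 1)) \<le> ?w x" by simp
  qed measurable
  then have "(\<lambda>n. ennreal (\<integral>x. P n x \<bullet> (B x, 1) \<partial>lebesgue)) \<longlonglongrightarrow> ennreal (\<integral>x. Q x \<bullet> (B x, 1) \<partial>lebesgue)"
    by (rule tendsto_ennrealI)
  then show ?thesis
    using admissible unfolding admissible_def by (intro LIMSEQ_le_const2) auto
qed

text \<open>Two limits are taken at once: the n-th approximant uses the first n balls of an
  enumeration, with bumps of parameter \<open>1 / Suc n\<close> in place of indicators.\<close>

lemma admissible_disjoint_balls:
  assumes K: "compact K" "K \<subseteq> \<Omega>" and C: "countable C"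
    "\<And>c r. (c, r) \<in> C \<Longrightarrow> 0 < r \<and> cball c r \<subseteq> K \<and> G c \<in> minorants \<and> norm (G c) \<le> R"
    and disj: "pairwise (\<lambda>i j. disjnt (ball (fst i) (snd i)) (ball (fst j) (snd j))) C"
    and H: "\<And>c r x. (c, r) \<in> C \<Longrightarrow> x \<in> ball c r \<Longrightarrow> H x = G c"
      "\<And>x. x \<notin> (\<Union>(c, r)\<in>C. ball c r) \<Longrightarrow> H x = 0"
    and R: "0 \<le> R"
  shows "admissible H" and "H \<in> borel_measurable lebesgue"
proof -
  define F where "F = (\<lambda>n. {j \<in> C. to_nat_on C j < n})"
  have F: "finite (F n)" "F n \<subseteq> C" for n
  proof -
    have "inj_on (to_nat_on C) (F n)"
      using C(1) by (auto intro: inj_on_subset[OF inj_on_to_nat_on] simp: F_def)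
    moreover have "finite (to_nat_on C ` F n)"
      by (rule finite_subset[of _ "{..<n}"]) (auto simp: F_def)
    ultimately show "finite (F n)" by (simp add: finite_image_iff)
  qed (auto simp: F_def)
  let ?b = "\<lambda>n j. bump (1 / Suc n) (fst j) (snd j)"
  define P where "P = (\<lambda>n x. \<Sum>j\<in>F n. ?b n j x *\<^sub>R G (fst j))"
  \<comment> \<open>By disjointness the sum collapses to the bump of the ball containing
    \<open>x\<close>, provided that ball is already enumerated.\<close>
  have P_ball: "P n x = (if j \<in> F n then ?b n j x *\<^sub>R G (fst j) else 0)"
    if j: "j \<in> C" "x \<in> ball (fst j) (snd j)" for n j x
  proof -
    have z: "?b n i x *\<^sub>R G (fst i) = 0" if "i \<in> F n - {j}" for i
      using disj j that F C(2)[of "fst i" "snd i"] bump_eq_0_iff[of "snd i" _ "fst i" x]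
      by (fastforce simp: pairwise_def disjnt_iff)
    show ?thesis
    proof (cases "j \<in> F n")
      case True
      have "(\<Sum>i\<in>F n - {j}. ?b n i x *\<^sub>R G (fst i)) = 0" by (rule sum.neutral) (use z in blast)
      with True show ?thesis using F(1) by (simp add: P_def sum.remove)
    next
      case False
      have "(\<Sum>i\<in>F n. ?b n i x *\<^sub>R G (fst i)) = 0" by (rule sum.neutral) (use z False in blast)
      with False show ?thesis by (simp add: P_def)
    qed
  qed
  have P_out: "P n x = 0" if "x \<notin> (\<Union>(c, r)\<in>C. ball c r)" for n x
  proof -
    have "?b n j x = 0" if "j \<in> F n" for j
    proof -
      have "j \<in> C" using that F by blast
      then show ?thesis
        using \<open>x \<notin> _\<close> C(2)[of "fst j" "snd j"] bump_eq_0_iff[of "snd j" _ "fst j" x]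
        by fastforce
    qed
    then show ?thesis by (simp add: P_def)
  qed
  have lim: "(\<lambda>n. P n x) \<longlonglongrightarrow> H x" for x
  proof (cases "x \<in> (\<Union>(c, r)\<in>C. ball c r)")
    case True
    then obtain c r where j: "(c, r) \<in> C" "x \<in> ball c r" by blast
    have "(\<lambda>n. bump (1 / Suc n) c r x *\<^sub>R G c) \<longlonglongrightarrow> indicator (ball c r) x *\<^sub>R G c"
      using C(2)[OF j(1)] by (intro tendsto_intros bump_tendsto_indicator) auto
    moreover have "eventually (\<lambda>n. P n x = bump (1 / Suc n) c r x *\<^sub>R G c) sequentially"
      using eventually_gt_at_top[of "to_nat_on C (c, r)"]
      by eventually_elim (use P_ball[of "(c, r)" x] j in \<open>auto simp: F_def\<close>)
    ultimately show ?thesis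
      using H(1)[OF j] j(2) by (simp add: tendsto_cong)
  qed (simp add: P_out H)
  have P_meas: "P n \<in> borel_measurable lebesgue" for n
    unfolding P_def
    by (intro borel_measurable_sum borel_measurable_scaleR bump_measurable) auto
  show meas: "H \<in> borel_measurable lebesgue"
    by (rule borel_measurable_LIMSEQ_metric[OF P_meas lim])
  show "admissible H"
  proof (rule admissible_limit[OF K, where P = P and R = R])
    show "norm (P n x) \<le> R" for n x
    proof (cases "x \<in> (\<Union>(c, r)\<in>C. ball c r)")
      case True
      then obtain c r where j: "(c, r) \<in> C" "x \<in> ball c r" by blast
      have "bump (1 / Suc n) c r x * norm (G c) \<le> 1 * R"
        using C(2)[OF j(1)] by (intro mult_mono bump_le_1) auto
      then show ?thesis using P_ball[of "(c, r)" x n] j R bump_nonneg[of _ c r x] by auto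
    qed (simp add: P_out R)
    show "P n x = 0" if "x \<notin> K" for n x
      using that C(2) ball_subset_cball by (intro P_out) blast
    show "admissible (P n)" for n
      unfolding P_def
    proof (rule admissible_bumps)
      show "pairwise (\<lambda>i j. disjnt (ball (fst i) (snd i)) (ball (fst j) (snd j))) (F n)"
        using pairwise_subset[OF disj F(2)] .
      show "G (fst j) \<in> minorants \<and> 0 < snd j \<and> cball (fst j) (snd j) \<subseteq> \<Omega>" if "j \<in> F n" for j
        using C(2)[of "fst j" "snd j"] F(2) that K by auto
    qed (use F in auto)
  qed (use lim P_meas meas in auto)
qed

text \<open>Vitali's theorem fills \<open>U\<close> up to a null set with disjoint balls of radius
  below \<open>1 / Suc n\<close>. Freezing \<open>G\<close> at their centers gives admissible
  fields, which converge to \<open>G\<close> almost everywhere by continuity.\<close>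

lemma admissible_continuous:
  assumes K: "compact K" "K \<subseteq> \<Omega>" and U: "open U" "U \<subseteq> K"
    and G: "continuous_on UNIV G" "\<And>x. G x \<in> minorants" "\<And>x. norm (G x) \<le> R"
  shows "admissible (\<lambda>x. indicator U x *\<^sub>R G x)"
proof -
  have R: "0 \<le> R" using G(3) order_trans[OF norm_ge_zero] by blast
  have G_meas: "G \<in> borel_measurable lebesgue"
    using G(1) continuous_imp_measurable_on_sets_lebesgue[of UNIV G] by (simp add: lebesgue_on_UNIV_eq)
  let ?V = "\<lambda>n. {(c, r). 0 < r \<and> r < 1 / real (Suc n) \<and> cball c r \<subseteq> U}"
  have "\<exists>C. countable C \<and> C \<subseteq> ?V n \<and>
      pairwise (\<lambda>i j. disjnt (ball (fst i) (snd i)) (ball (fst j) (snd j))) C \<and>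
      negligible (U - (\<Union>i\<in>C. ball (fst i) (snd i)))" for n
  proof -
    have "\<exists>i. i \<in> ?V n \<and> x \<in> ball (fst i) (snd i) \<and> snd i < d" if "x \<in> U" "0 < d" for x d
    proof -
      obtain e where e: "0 < e" "cball x e \<subseteq> U" using U(1) \<open>x \<in> U\<close> open_contains_cball by blast
      have "0 < min e (min d (1 / real (Suc n)))" using e(1) \<open>0 < d\<close> by simp
      from dense[OF this] obtain r where r: "0 < r" "r < min e (min d (1 / real (Suc n)))" by blast
      then have "cball x r \<subseteq> U" using e(2) subset_cball[of r e x] by simp
      with r show ?thesis by (intro exI[of _ "(x, r)"]) auto
    qed
    from Vitali_covering_theorem_balls[of U "?V n" fst snd, OF this] show ?thesis by blast
  qed
  then have "\<forall>n. \<exists>C. countable C \<and> C \<subseteq> ?V n \<and>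
      pairwise (\<lambda>i j. disjnt (ball (fst i) (snd i)) (ball (fst j) (snd j))) C \<and>
      negligible (U - (\<Union>i\<in>C. ball (fst i) (snd i)))" by blast
  from choice[OF this] obtain C where C: "\<forall>n. countable (C n) \<and> C n \<subseteq> ?V n \<and>
      pairwise (\<lambda>i j. disjnt (ball (fst i) (snd i)) (ball (fst j) (snd j))) (C n) \<and>
      negligible (U - (\<Union>i\<in>C n. ball (fst i) (snd i)))" ..
  note C = C[rule_format, THEN conjunct1] C[rule_format, THEN conjunct2, THEN conjunct1]
    C[rule_format, THEN conjunct2, THEN conjunct2, THEN conjunct1]
    C[rule_format, THEN conjunct2, THEN conjunct2, THEN conjunct2]
  \<comment> \<open>The ball of the n-th family that contains \<open>x\<close>; disjointness makes
    the choice unique.\<close>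
  define j where "j = (\<lambda>n x. SOME i. i \<in> C n \<and> x \<in> ball (fst i) (snd i))"
  have j: "j n x = i" if "i \<in> C n" "x \<in> ball (fst i) (snd i)" for n i x
    unfolding j_def
    using that C(3)[of n] by (intro some_equality) (auto simp: pairwise_def disjnt_iff)
  define H where "H = (\<lambda>n x. if x \<in> (\<Union>i\<in>C n. ball (fst i) (snd i)) then G (fst (j n x)) else 0)"
  have H: "admissible (H n)" "H n \<in> borel_measurable lebesgue" for n
  proof -
    have 1: "0 < r \<and> cball c r \<subseteq> K \<and> G c \<in> minorants \<and> norm (G c) \<le> R" if "(c, r) \<in> C n" for c r
      using that C(2)[of n] U(2) G by auto
    have 2: "H n x = G c" if "(c, r) \<in> C n" "x \<in> ball c r" for c r x
      using that j[of "(c, r)" n x] unfolding H_def by fastforce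
    have 3: "H n x = 0" if "x \<notin> (\<Union>(c, r)\<in>C n. ball c r)" for x
      using that unfolding H_def by (auto simp: case_prod_beta)
    show "admissible (H n)" by (rule admissible_disjoint_balls(1)[OF K C(1) 1 C(3) 2 3 R])
    show "H n \<in> borel_measurable lebesgue"
      by (rule admissible_disjoint_balls(2)[OF K C(1) 1 C(3) 2 3 R])
  qed
  have [measurable]: "U \<in> sets lebesgue" using U(1) by auto
  have H_out: "H n x = 0" if "x \<notin> U" for n x
  proof -
    have "x \<notin> ball (fst i) (snd i)" if "i \<in> C n" for i
    proof -
      have "i \<in> ?V n" using C(2)[of n] that by (rule subsetD)
      then have "cball (fst i) (snd i) \<subseteq> U" by (simp add: case_prod_beta)
      then show ?thesis using \<open>x \<notin> U\<close> mem_cball mem_ball less_imp_le by blast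
    qed
    then show ?thesis by (auto simp: H_def)
  qed
  show ?thesis
  proof (rule admissible_limit[OF K, where P = H and R = R])
    show "(\<lambda>x. indicator U x *\<^sub>R G x) \<in> borel_measurable lebesgue" using G_meas by measurable
    show "norm (H n x) \<le> R" for n x using G(3) R by (simp add: H_def)
    show "H n x = 0" if "x \<notin> K" for n x using that U(2) by (intro H_out) auto
    \<comment> \<open>Outside this one null set, every point of \<open>U\<close> is covered by all
      the families simultaneously.\<close>
    have "(\<Union>n. U - (\<Union>i\<in>C n. ball (fst i) (snd i))) \<in> null_sets lebesgue"
      using C(4) by (intro null_sets_UN) (simp add: negligible_iff_null_sets)
    then have "AE x in lebesgue. x \<notin> (\<Union>n. U - (\<Union>i\<in>C n. ball (fst i) (snd i)))"
      by (rule AE_not_in)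
    then show "AE x in lebesgue. (\<lambda>n. H n x) \<longlonglongrightarrow> indicator U x *\<^sub>R G x"
    proof eventually_elim
      case (elim x)
      show ?case
      proof (cases "x \<in> U")
        case True
        have jx: "H n x = G (fst (j n x)) \<and> dist (fst (j n x)) x < 1 / real (Suc n)" for n
        proof -
          obtain i where i: "i \<in> C n" "x \<in> ball (fst i) (snd i)" using elim True by blast
          have "snd i < 1 / real (Suc n)" using C(2)[of n] i(1) by auto
          then show ?thesis using i j[OF i] by (auto simp: H_def)
        qed
        have "(\<lambda>n. fst (j n x)) \<longlonglongrightarrow> x"
        proof (rule metric_tendsto_imp_tendsto[OF LIMSEQ_Suc[OF lim_1_over_n]])
          show "\<forall>\<^sub>F n in sequentially. dist (fst (j n x)) x \<le> dist (1 / real (Suc n)) 0"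
            using jx by (intro always_eventually allI) (simp add: less_imp_le)
        qed
        then have "(\<lambda>n. G (fst (j n x))) \<longlonglongrightarrow> G x"
          using G(1) by (intro isCont_tendsto_compose[of x G]) (simp_all add: continuous_on_eq_continuous_at)
        then show ?thesis using True jx by simp
      qed (simp add: H_out)
    qed
  qed (use H in auto)
qed

text \<open>Lebesgue measurable functions are almost everywhere limits of continuous ones; projecting onto the
  convex set of bounded minorants keeps the approximants admissible.\<close>

lemma admissible_measurable:
  assumes K: "compact K" "K \<subseteq> \<Omega>" and U: "open U" "U \<subseteq> K"
    and P: "P \<in> borel_measurable lebesgue" "\<And>x. P x \<in> minorants" "\<And>x. norm (P x) \<le> R"
  shows "admissible (\<lambda>x. indicator U x *\<^sub>R P x)"
proof -
  have "P measurable_on UNIV"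
    by (rule lebesgue_measurable_imp_measurable_on[OF P(1)]) simp
  then obtain N g where g: "negligible N" "\<And>n. continuous_on UNIV (g n)"
    "\<And>x. x \<notin> N \<Longrightarrow> (\<lambda>n. g n x) \<longlonglongrightarrow> P x"
    by (auto simp: measurable_on_def)
  \<comment> \<open>The ball of radius \<open>R\<close> contains all values of \<open>P\<close>, so
    the projection fixes them; it also supplies the uniform bound for dominated convergence.\<close>
  let ?M = "minorants \<inter> cball 0 R"
  have M: "convex ?M" "closed ?M" "?M \<noteq> {}"
    using P(2,3)[of undefined] by (auto intro!: convex_Int convex_minorants closed_Int closed_minorants)
  let ?g = "\<lambda>n x. closest_point ?M (g n x)"
  have g_M: "?g n x \<in> ?M" for n x using closest_point_in_set[OF M(2,3)] .
  have g_cont: "continuous_on UNIV (?g n)" for n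
    by (rule continuous_on_compose2[OF continuous_on_closest_point[OF M] g(2)]) auto
  have g_meas: "?g n \<in> borel_measurable lebesgue" for n
    using g_cont[of n] continuous_imp_measurable_on_sets_lebesgue[of UNIV "?g n"] by (simp add: lebesgue_on_UNIV_eq)
  have [measurable]: "U \<in> sets lebesgue" using U(1) by auto
  have R: "0 \<le> R" using P(3) order_trans[OF norm_ge_zero] by blast
  show ?thesis
  proof (rule admissible_limit[OF K, where P = "\<lambda>n x. indicator U x *\<^sub>R ?g n x" and R = R])
    show "admissible (\<lambda>x. indicator U x *\<^sub>R ?g n x)" for n
      using g_M[of n] by (intro admissible_continuous[OF K U, where R = R] g_cont) auto
    show "AE x in lebesgue. (\<lambda>n. indicator U x *\<^sub>R ?g n x) \<longlonglongrightarrow> indicator U x *\<^sub>R P x"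
    proof -
      have "AE x in lebesgue. x \<notin> N" using g(1) by (intro AE_not_in) (simp add: negligible_iff_null_sets)
      then show ?thesis
      proof eventually_elim
        case (elim x)
        have "(\<lambda>n. ?g n x) \<longlonglongrightarrow> closest_point ?M (P x)"
          by (rule isCont_tendsto_compose[OF continuous_at_closest_point[OF M] g(3)[OF elim]])
        also have "closest_point ?M (P x) = P x" using P by (intro closest_point_self) auto
        finally show ?case by (intro tendsto_intros)
      qed
    qed
    show "norm (indicator U x *\<^sub>R ?g n x) \<le> R" for n x
      using g_M[of n x] R by (simp add: indicator_def)
    show "indicator U x *\<^sub>R ?g n x = 0" if "x \<notin> K" for n x
      using that U(2) by (auto simp: indicator_def)
  qed (use g_meas P(1) in measurable)
qed

text \<open>A subgradient at \<open>X\<close> gives a minorant touching \<Phi> at \<open>X\<close>,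
  which by continuity stays within \<open>e\<close> of \<Phi> on a neighbourhood. Lindelof leaves
  countably many of them, so that a good one can be selected measurably.\<close>

lemma countable_minorants:
  assumes "0 < e"
  obtains q :: "nat \<Rightarrow> 'b \<times> real" where "\<And>i. q i \<in> minorants" "\<And>X. \<exists>i. \<Phi> X - e < q i \<bullet> (X, 1)"
proof -
  let ?W = "\<lambda>q :: 'b \<times> real. {X. \<Phi> X - e < q \<bullet> (X, 1)}"
  have W: "open (?W q)" for q
    by (intro open_Collect_less continuous_intros continuous)
  obtain \<F> where \<F>: "\<F> \<subseteq> ?W ` minorants" "countable \<F>" "\<Union>\<F> = \<Union>(?W ` minorants)"
  proof (rule Lindelof[of "?W ` minorants"])
    show "open S" if "S \<in> ?W ` minorants" for S using that W by (elim imageE) simp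
  qed (rule that)
  have cover: "X \<in> \<Union>\<F>" for X
  proof -
    obtain p where p: "\<And>Y. \<Phi> X + p \<bullet> (Y - X) \<le> \<Phi> Y" using subgradient by blast
    \<comment> \<open>The tangent function at \<open>X\<close> in the pair encoding.\<close>
    have "(p, \<Phi> X - p \<bullet> X) \<in> minorants"
      using p by (simp add: minorants_def inner_prod_def inner_diff_right algebra_simps)
    moreover have "X \<in> ?W (p, \<Phi> X - p \<bullet> X)" using assms by (simp add: inner_prod_def)
    ultimately show ?thesis unfolding \<F>(3) by (rule UN_I)
  qed
  from countable_subset_image[THEN iffD1, OF conjI[OF \<F>(2,1)]]
  obtain D where D: "countable D" "D \<subseteq> minorants" "\<F> = ?W ` D" by (elim exE conjE) (rule that)
  have "D \<noteq> {}" using cover D(3) by auto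
  show ?thesis
  proof (rule that[of "from_nat_into D"])
    show "from_nat_into D i \<in> minorants" for i
      using from_nat_into[OF \<open>D \<noteq> {}\<close>] D(2) by blast
    show "\<exists>i. \<Phi> X - e < from_nat_into D i \<bullet> (X, 1)" for X
    proof -
      obtain q where "q \<in> D" "X \<in> ?W q" using cover[of X] D(3) by auto
      then show ?thesis using from_nat_into_surj[OF D(1)] by blast
    qed
  qed
qed

text \<open>At each point the first minorant of the countable list that is within \<open>e\<close>
  of \<Phi>(B x) is selected. The selection is measurable, and it loses at most \<open>e\<close>
  times the measure of \<open>U\<close>.\<close>

lemma local_lower_semicontinuity:
  assumes K: "compact K" "K \<subseteq> \<Omega>" and U: "open U" "U \<subseteq> K"
  shows "(\<integral>\<^sup>+x\<in>U. ennreal (\<Phi> (B x)) \<partial>lebesgue) \<le> liminf_energy"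
proof (rule ennreal_le_epsilon)
  fix e' :: real assume "0 < e'"
  define m where "m = measure lebesgue U"
  \<comment> \<open>Chosen so that the total loss \<open>e * m\<close> is at most \<open>e'\<close>;
    the summand 1 covers \<open>m = 0\<close>.\<close>
  define e where "e = e' / (m + 1)"
  have "0 \<le> m" by (simp add: m_def)
  then have e: "0 < e" using \<open>0 < e'\<close> by (simp add: e_def)
  have "e * m \<le> e * (m + 1)" using e by (intro mult_left_mono) auto
  also have "\<dots> = e'" using \<open>0 \<le> m\<close> by (simp add: e_def)
  finally have e_m: "e * m \<le> e'" .
  obtain q :: "nat \<Rightarrow> 'b \<times> real" where q: "\<And>i. q i \<in> minorants" "\<And>X. \<exists>i. \<Phi> X - e < q i \<bullet> (X, 1)"
    by (rule countable_minorants[OF e]) (rule that)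
  have [measurable]: "U \<in> sets lebesgue" using U(1) by auto
  have [measurable]: "\<Phi> \<in> borel_measurable borel"
    using continuous by (rule borel_measurable_continuous_onI)
  have "bounded U" using K(1) U(2) bounded_subset compact_imp_bounded by blast
  then have U_fin: "emeasure lebesgue U < \<infinity>"
    using U(1) emeasure_bounded_finite[of U] by simp
  define l where "l = (\<lambda>x. LEAST i. \<Phi> (B x) - e < q i \<bullet> (B x, 1))"
  have l: "\<Phi> (B x) - e < q (l x) \<bullet> (B x, 1)" for x
    unfolding l_def using q(2)[of "B x"] by (rule LeastI_ex)
  have [measurable]: "l \<in> measurable lebesgue (count_space UNIV)"
    unfolding l_def by measurable
  \<comment> \<open>Using only the first \<open>n\<close> minorants makes the field bounded.
    Elsewhere the value is 0, itself a minorant.\<close>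
  define P where "P = (\<lambda>n x. if l x < n then q (l x) else 0)"
  let ?f = "\<lambda>n x. indicator U x * (if l x < n then \<Phi> (B x) else 0)"
  have bd: "(\<integral>\<^sup>+x. ennreal (?f n x) \<partial>lebesgue) \<le> liminf_energy + ennreal e'" for n
  proof -
    define R where "R = (\<Sum>i<n. norm (q i))"
    have PR: "norm (P n x) \<le> R" for x
      unfolding P_def R_def by (auto intro!: member_le_sum sum_nonneg)
    have [measurable]: "P n \<in> borel_measurable lebesgue"
      unfolding P_def by measurable
    let ?g = "\<lambda>x. (indicator U x *\<^sub>R P n x) \<bullet> (B x, 1)"
    have g: "ennreal (integral\<^sup>L lebesgue ?g) \<le> liminf_energy"
      using admissible_measurable[OF K U _ _ PR] q(1) zero_minorant unfolding admissible_def by (auto simp: P_def)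
    have U_int: "integrable lebesgue (indicator U :: 'a \<Rightarrow> real)"
      using U_fin by (intro integrable_real_indicator) auto
    have g_int: "integrable lebesgue ?g"
    proof (rule Bochner_Integration.integrable_bound)
      show "integrable lebesgue (\<lambda>x. R * (norm (indicator K x *\<^sub>R B x) + indicator U x))"
        using B_integrable[OF K] U_int
        by (intro integrable_mult_right Bochner_Integration.integrable_add integrable_norm)
           (auto simp: set_integrable_def)
      have "norm (?g x) \<le> R * (norm (indicator K x *\<^sub>R B x) + indicator U x)" for x
      proof (cases "x \<in> U")
        case True
        have "norm (P n x \<bullet> (B x, 1)) \<le> norm (P n x) * norm (B x, 1::real)"
          by (simp add: Cauchy_Schwarz_ineq2)
        also have "\<dots> \<le> R * (norm (B x) + norm (1::real))"
          using PR[of x] by (intro mult_mono norm_Pair_le) (auto intro: order_trans[OF norm_ge_zero])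
        finally show ?thesis using True U(2) by (auto simp: indicator_def)
      qed (use order_trans[OF norm_ge_zero PR] in simp)
      then show "AE x in lebesgue. norm (?g x) \<le> norm (R * (norm (indicator K x *\<^sub>R B x) + indicator U x))"
        by (intro AE_I2, simp only: real_norm_def) (rule order_trans[OF _ abs_ge_self])
      show "?g \<in> borel_measurable lebesgue"
        by (intro borel_measurable_inner borel_measurable_scaleR borel_measurable_Pair) measurable
    qed
    have le: "?f n x \<le> ?g x + e * indicator U x" for x
    proof (cases "x \<in> U")
      case True
      have "(if l x < n then \<Phi> (B x) else 0) \<le> P n x \<bullet> (B x, 1) + e"
        using l[of x] e unfolding P_def by (cases "l x < n") simp_all
      with True show ?thesis by simp
    qed simp
    have nn: "0 \<le> ?f n x" for x using nonneg by auto
    have "(\<integral>\<^sup>+x. ennreal (?f n x) \<partial>lebesgue) \<le> (\<integral>\<^sup>+x. ennreal (?g x + e * indicator U x) \<partial>lebesgue)"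
      using le by (intro nn_integral_mono ennreal_leI)
    also have "\<dots> = ennreal (\<integral>x. ?g x + e * indicator U x \<partial>lebesgue)"
      using g_int U_int order_trans[OF nn le]
      by (intro nn_integral_eq_integral Bochner_Integration.integrable_add integrable_mult_right) auto
    also have "(\<integral>x. ?g x + e * indicator U x \<partial>lebesgue) = integral\<^sup>L lebesgue ?g + e * m"
      using g_int U_int by (simp add: m_def)
    also have "ennreal \<dots> \<le> ennreal (integral\<^sup>L lebesgue ?g) + ennreal (e * m)"
      using e \<open>0 \<le> m\<close> by (simp add: ennreal_plus_if)
    also have "\<dots> \<le> liminf_energy + ennreal e'"
      using g e_m by (intro add_mono ennreal_leI) auto
    finally show ?thesis .
  qed
  have lim: "(\<lambda>n. ennreal (?f n x)) \<longlonglongrightarrow> ennreal (\<Phi> (B x)) * indicator U x" for x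
  proof (rule tendsto_eventually)
    show "\<forall>\<^sub>F n in sequentially. ennreal (?f n x) = ennreal (\<Phi> (B x)) * indicator U x"
      using eventually_gt_at_top[of "l x"] by eventually_elim (simp add: indicator_def)
  qed
  have "(\<integral>\<^sup>+x\<in>U. ennreal (\<Phi> (B x)) \<partial>lebesgue) = (\<integral>\<^sup>+x. liminf (\<lambda>n. ennreal (?f n x)) \<partial>lebesgue)"
    using lim by (intro nn_integral_cong lim_imp_Liminf[symmetric]) auto
  also have "\<dots> \<le> liminf (\<lambda>n. \<integral>\<^sup>+x. ennreal (?f n x) \<partial>lebesgue)"
    by (rule nn_integral_liminf) measurable
  also have "\<dots> \<le> liminf (\<lambda>n. liminf_energy + ennreal e')"
    by (intro Liminf_mono always_eventually allI bd)
  finally show "(\<integral>\<^sup>+x\<in>U. ennreal (\<Phi> (B x)) \<partial>lebesgue) \<le> liminf_energy + ennreal e'"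
    by (simp add: Liminf_const)
qed

text \<open>The local inequality has a right-hand side independent of the set, so it survives
  exhausting the domain by interiors of compact sets, by Fatou.\<close>

lemma lower_semicontinuity:
  "(\<integral>\<^sup>+x\<in>\<Omega>. ennreal (\<Phi> (B x)) \<partial>lebesgue) \<le> liminf (\<lambda>h. \<integral>\<^sup>+x\<in>\<Omega>. ennreal (\<Phi> (A h x)) \<partial>lebesgue)"
proof -
  obtain C :: "nat \<Rightarrow> 'a set" where C: "\<And>n. compact (C n)" "\<And>n. C n \<subseteq> \<Omega>" "\<And>n. C n \<subseteq> interior (C (Suc n))" "\<Union>(range C) = \<Omega>"
    "\<And>K. \<lbrakk>compact K; K \<subseteq> \<Omega>\<rbrakk> \<Longrightarrow> \<exists>N. \<forall>n\<ge>N. K \<subseteq> C n"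
    by (rule open_Union_compact_subsets[OF open_domain]) (rule that)
  let ?U = "\<lambda>n. interior (C n)"
  have [measurable]: "\<Phi> \<in> borel_measurable borel"
    using continuous by (rule borel_measurable_continuous_onI)
  have [measurable]: "?U n \<in> sets lebesgue" for n by simp
  have mono: "?U m \<subseteq> ?U n" if "m \<le> n" for m n
    by (rule lift_Suc_mono_le[where f = ?U, OF order_trans[OF interior_subset C(3)] that])
  have lim: "(\<lambda>n. ennreal (\<Phi> (B x)) * indicator (?U n) x) \<longlonglongrightarrow> ennreal (\<Phi> (B x)) * indicator \<Omega> x" for x
  proof (rule tendsto_eventually)
    show "\<forall>\<^sub>F n in sequentially. ennreal (\<Phi> (B x)) * indicator (?U n) x = ennreal (\<Phi> (B x)) * indicator \<Omega> x"
    proof (cases "x \<in> \<Omega>")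
      case True
      then obtain m where "x \<in> C m" using C(4) by blast
      then have "x \<in> ?U (Suc m)" using C(3) by blast
      show ?thesis
        using eventually_ge_at_top[of "Suc m"]
      proof eventually_elim
        case (elim n)
        then have "x \<in> ?U n" using mono[OF elim] \<open>x \<in> ?U (Suc m)\<close> by blast
        with True show ?case by simp
      qed
    next
      case False
      then have "x \<notin> ?U n" for n using C(2) interior_subset by blast
      with False show ?thesis by simp
    qed
  qed
  have "(\<integral>\<^sup>+x\<in>\<Omega>. ennreal (\<Phi> (B x)) \<partial>lebesgue) = (\<integral>\<^sup>+x. liminf (\<lambda>n. ennreal (\<Phi> (B x)) * indicator (?U n) x) \<partial>lebesgue)"
    using lim by (intro nn_integral_cong lim_imp_Liminf[symmetric]) auto
  also have "\<dots> \<le> liminf (\<lambda>n. \<integral>\<^sup>+x\<in>?U n. ennreal (\<Phi> (B x)) \<partial>lebesgue)"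
    by (rule nn_integral_liminf) measurable
  also have "\<dots> \<le> liminf (\<lambda>n. liminf_energy)"
    by (intro Liminf_mono always_eventually allI local_lower_semicontinuity[OF C(1,2) open_interior interior_subset])
  finally show ?thesis by (simp add: Liminf_const liminf_energy_def)
qed

end

section \<open>Strictly convex radial integrands\<close>

locale strictly_convex_gauge =
  fixes \<phi> :: "real \<Rightarrow> real"
  assumes strictly_convex: "strictly_convex_on {0..} \<phi>"
    and zero: "\<phi> 0 = 0"
    and nonneg: "\<And>t. 0 \<le> t \<Longrightarrow> 0 \<le> \<phi> t"
begin

lemma less_combination:
  "0 \<le> x \<Longrightarrow> 0 \<le> y \<Longrightarrow> x \<noteq> y \<Longrightarrow> 0 < t \<Longrightarrow> t < 1 \<Longrightarrow> \<phi> ((1 - t) * x + t * y) < (1 - t) * \<phi> x + t * \<phi> y"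
  using strictly_convex by (simp add: strictly_convex_on_def)

lemma le_combination:
  assumes "0 \<le> x" "0 \<le> y" "0 \<le> t" "t \<le> 1"
  shows "\<phi> ((1 - t) * x + t * y) \<le> (1 - t) * \<phi> x + t * \<phi> y"
proof -
  consider "x = y" | "t = 0" | "t = 1" | "x \<noteq> y" "0 < t" "t < 1" using assms by linarith
  then show ?thesis
    by cases (use less_combination[of x y t] assms in \<open>auto simp: algebra_simps\<close>)
qed

text \<open>Everything comes from chords starting at the origin. The midpoint of 0 and
  \<open>y\<close> gives \<open>0 < \<phi> y\<close>; then the chord from 0 to \<open>y\<close> lies
  above \<phi> at \<open>x\<close> and below \<open>\<phi> y\<close>.\<close>

lemma strict_mono_gauge:
  assumes "0 \<le> x" "x < y"
  shows "\<phi> x < \<phi> y"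
proof -
  have pos: "0 < \<phi> y"
    using less_combination[of 0 y "1/2"] nonneg[of "y / 2"] zero assms by simp
  show ?thesis
  proof (cases "x = 0")
    case False
    then have "0 < x / y" "x / y < 1" using assms by auto
    then have "\<phi> x < (x / y) * \<phi> y"
      using less_combination[of 0 y "x / y"] zero assms by simp
    also have "\<dots> < 1 * \<phi> y" using pos \<open>x / y < 1\<close> by (intro mult_strict_right_mono)
    finally show ?thesis by simp
  qed (use pos zero in simp)
qed

lemma mono_gauge: "0 \<le> x \<Longrightarrow> x \<le> y \<Longrightarrow> \<phi> x \<le> \<phi> y"
  using strict_mono_gauge[of x y] by (cases "x = y") auto

lemma convex_gauge: "convex_on UNIV (\<lambda>X :: 'b::real_normed_vector. \<phi> (norm X))"
proof (rule convex_onI)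
  fix t :: real and X Y :: 'b assume t: "0 < t" "t < 1"
  have "norm ((1 - t) *\<^sub>R X + t *\<^sub>R Y) \<le> (1 - t) * norm X + t * norm Y"
    using norm_triangle_ineq[of "(1 - t) *\<^sub>R X" "t *\<^sub>R Y"] t by simp
  then have "\<phi> (norm ((1 - t) *\<^sub>R X + t *\<^sub>R Y)) \<le> \<phi> ((1 - t) * norm X + t * norm Y)"
    by (intro mono_gauge) auto
  also have "\<dots> \<le> (1 - t) * \<phi> (norm X) + t * \<phi> (norm Y)"
    using t by (intro le_combination) auto
  finally show "\<phi> (norm ((1 - t) *\<^sub>R X + t *\<^sub>R Y)) \<le> (1 - t) * \<phi> (norm X) + t * \<phi> (norm Y)" .
qed simp

lemma continuous_gauge: "continuous_on UNIV (\<lambda>X :: 'b::euclidean_space. \<phi> (norm X))"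
  using convex_on_continuous[OF open_UNIV convex_gauge] .

text \<open>A one-dimensional slope of \<phi>(|t|) at the norm of \<open>S\<close> is transported to
  the direction of \<open>S\<close>; Cauchy-Schwarz compares the inner product with the norm, which
  is legitimate as the slope is nonnegative. At the origin, a minimum, the zero vector
  works.\<close>

lemma subgradient_gauge:
  fixes S :: "'b::real_inner"
  shows "\<exists>p. \<forall>X. \<phi> (norm S) + p \<bullet> (X - S) \<le> \<phi> (norm X)"
proof (cases "S = 0")
  case True
  then show ?thesis using zero nonneg by (intro exI[of _ 0]) simp
next
  case False
  obtain m where m: "\<phi> \<bar>y\<bar> \<ge> \<phi> (norm S) + m * (y - norm S)" for y
    using convex_le_Inf_differential[OF convex_gauge[where 'b=real], of "norm S"] by auto
  \<comment> \<open>Testing the slope inequality at 0, where \<phi> vanishes.\<close>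
  have "0 \<le> m * norm S" using m[of 0] zero nonneg[of "norm S"] by simp
  then have "0 \<le> m" using False by (simp add: zero_le_mult_iff)
  have "\<phi> (norm S) + ((m / norm S) *\<^sub>R S) \<bullet> (X - S) \<le> \<phi> (norm X)" for X
  proof -
    have "S \<bullet> X / norm S \<le> norm X"
      using norm_cauchy_schwarz[of S X] False by (simp add: divide_le_eq mult.commute)
    then have "m * (S \<bullet> X / norm S - norm S) \<le> m * (norm X - norm S)"
      using \<open>0 \<le> m\<close> by (intro mult_left_mono) auto
    moreover have "((m / norm S) *\<^sub>R S) \<bullet> (X - S) = m * (S \<bullet> X / norm S - norm S)"
      using False by (simp add: inner_diff_right dot_square_norm power2_eq_square field_simps)
    ultimately show ?thesis using m[of "norm X"] by simp
  qed
  then show ?thesis by blast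
qed

section \<open>The convexity gap at the midpoint\<close>

definition gap :: "'b::real_normed_vector \<Rightarrow> 'b \<Rightarrow> real" where
  "gap X Y = (\<phi> (norm X) + \<phi> (norm Y)) / 2 - \<phi> (norm ((1 / 2) *\<^sub>R (X + Y)))"

lemma gap_nonneg: "0 \<le> gap X Y"
  using convex_onD[OF convex_gauge, of "1/2" X Y] by (simp add: gap_def scaleR_add_right)

text \<open>If the norms differ, strict convexity of \<phi> is decisive. If they agree, the
  parallelogram law makes the midpoint strictly shorter, and strict monotonicity of \<phi> is
  decisive.\<close>

lemma gap_pos:
  fixes X Y :: "'b::real_inner"
  assumes "X \<noteq> Y"
  shows "0 < gap X Y"
proof (cases "norm X = norm Y")
  case False
  have "\<phi> (norm ((1 / 2) *\<^sub>R (X + Y))) \<le> \<phi> ((1 - 1/2) * norm X + (1/2) * norm Y)"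
    using norm_triangle_ineq[of X Y] by (intro mono_gauge) auto
  also have "\<dots> < (1 - 1/2) * \<phi> (norm X) + (1/2) * \<phi> (norm Y)"
    using False by (intro less_combination) auto
  finally show ?thesis by (simp add: gap_def field_simps)
next
  case True
  have "(norm (X + Y))\<^sup>2 + (norm (X - Y))\<^sup>2 = 2 * (norm X)\<^sup>2 + 2 * (norm Y)\<^sup>2"
    by (simp add: power2_norm_eq_inner inner_add inner_diff algebra_simps)
  moreover have "0 < (norm (X - Y))\<^sup>2" using assms by simp
  moreover have "(2 * norm X)\<^sup>2 = 2 * (norm X)\<^sup>2 + 2 * (norm Y)\<^sup>2"
    using True by (simp add: power_mult_distrib)
  ultimately have "(norm (X + Y))\<^sup>2 < (2 * norm X)\<^sup>2" by linarith
  then have "norm (X + Y) < 2 * norm X" by (rule power2_less_imp_less) simp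
  then have "\<phi> (norm ((1 / 2) *\<^sub>R (X + Y))) < \<phi> (norm X)"
    by (intro strict_mono_gauge) auto
  then show ?thesis using True by (simp add: gap_def)
qed

text \<open>The common term at \<open>Y\<close> cancels and the claim becomes
  \<open>?N C + 2 * ?N M \<le> 2 * ?N D + ?N X\<close>. This is convexity on the segment from
  \<open>D\<close> to \<open>X\<close>, applied once at \<open>C\<close> and twice at
  \<open>M\<close>; the weights match because \<open>a + 2 * c = 1\<close>.\<close>

lemma gap_mono_ray:
  assumes s: "0 \<le> s" "s \<le> 1"
  shows "gap (Y + s *\<^sub>R (X - Y)) Y \<le> gap X Y"
proof -
  let ?N = "\<lambda>X :: 'a. \<phi> (norm X)"
  define C where "C = Y + s *\<^sub>R (X - Y)"
  define M where "M = (1 / 2) *\<^sub>R (X + Y)"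
  define D where "D = (1 / 2) *\<^sub>R (C + Y)"
  \<comment> \<open>On the ray, \<open>C\<close> and \<open>M\<close> lie between \<open>D\<close> and \<open>X\<close>; \<open>a\<close> and \<open>c\<close> are their barycentric coordinates.\<close>
  define a where "a = s / (2 - s)"
  define c where "c = (1 - s) / (2 - s)"
  have ac: "0 \<le> a" "a \<le> 1" "0 \<le> c" "c \<le> 1" "a + 2 * c = 1" "(1 - a) * s / 2 + a = s" "(1 - c) * s / 2 + c = 1 / 2"
  proof -
    define p where "p = 2 - s"
    have p: "0 < p" "s = 2 - p" using s by (simp_all add: p_def)
    show "a + 2 * c = 1" "(1 - a) * s / 2 + a = s" "(1 - c) * s / 2 + c = 1 / 2"
      using p(1) unfolding a_def c_def p(2) by (simp_all add: field_simps)
  qed (use s in \<open>simp_all add: a_def c_def field_simps\<close>)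
  have ray: "(1 - u) *\<^sub>R D + u *\<^sub>R X = Y + ((1 - u) * s / 2 + u) *\<^sub>R (X - Y)" for u
  proof -
    have "D = Y + (s / 2) *\<^sub>R (X - Y)"
      by (simp add: D_def C_def scaleR_add_right scaleR_add_left[symmetric])
    then have "(1 - u) *\<^sub>R D + u *\<^sub>R X = (1 - u) *\<^sub>R Y + ((1 - u) * s / 2) *\<^sub>R (X - Y) + u *\<^sub>R Y + u *\<^sub>R (X - Y)"
      by (simp add: scaleR_add_right scaleR_diff_right)
    then show ?thesis by (simp add: scaleR_add_left scaleR_diff_left)
  qed
  have "C = (1 - a) *\<^sub>R D + a *\<^sub>R X"
    unfolding ray ac(6) C_def ..
  then have "?N C \<le> (1 - a) * ?N D + a * ?N X"
    using convex_onD[OF convex_gauge, of a D X] ac by simp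
  moreover have "M = (1 - c) *\<^sub>R D + c *\<^sub>R X"
  proof -
    have "Y = (1 / 2) *\<^sub>R Y + (1 / 2) *\<^sub>R Y" by (simp add: scaleR_add_left[symmetric])
    then show ?thesis unfolding ray ac(7) M_def by (simp add: scaleR_add_right scaleR_diff_right algebra_simps)
  qed
  then have "?N M \<le> (1 - c) * ?N D + c * ?N X"
    using convex_onD[OF convex_gauge, of c D X] ac by simp
  ultimately have "?N C + 2 * ?N M \<le> (3 - (a + 2 * c)) * ?N D + (a + 2 * c) * ?N X"
    by (simp add: algebra_simps)
  then have "?N C + 2 * ?N M \<le> 2 * ?N D + ?N X" using ac(5) by simp
  then show ?thesis
    unfolding gap_def C_def[symmetric] M_def[symmetric] D_def[symmetric] by (simp add: field_simps)
qed

text \<open>On the compact sphere of radius \<open>e\<close> around \<open>Y\<close> the gap has a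
  positive minimum, and monotonicity along rays makes it a lower bound everywhere outside the ball.
  No boundedness of the sequence has to be known in advance.\<close>

lemma gap_tendsto_0_imp_tendsto:
  fixes X :: "nat \<Rightarrow> 'b::euclidean_space"
  assumes "(\<lambda>n. gap (X n) Y) \<longlonglongrightarrow> 0"
  shows "X \<longlonglongrightarrow> Y"
proof (rule metric_LIMSEQ_I)
  fix e :: real assume e: "0 < e"
  have "continuous_on (sphere Y e) (\<lambda>X. gap X Y)"
    unfolding gap_def
    by (intro continuous_intros continuous_on_compose2[OF continuous_gauge]) auto
  then obtain Z where Z: "Z \<in> sphere Y e" "\<And>X. X \<in> sphere Y e \<Longrightarrow> gap Z Y \<le> gap X Y"
    using continuous_attains_inf[of "sphere Y e" "\<lambda>X. gap X Y"] e by auto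
  have "Z \<noteq> Y" using Z(1) e by auto
  then have "eventually (\<lambda>n. gap (X n) Y < gap Z Y) sequentially"
    by (intro order_tendstoD(2)[OF assms] gap_pos)
  then have "eventually (\<lambda>n. dist (X n) Y < e) sequentially"
  proof eventually_elim
    case (elim n)
    show ?case
    proof (rule ccontr)
      assume "\<not> dist (X n) Y < e"
      then have ge: "e \<le> norm (X n - Y)" by (simp add: dist_norm)
      \<comment> \<open>Pulls \<open>X n\<close> back along its ray onto the sphere.\<close>
      define s where "s = e / norm (X n - Y)"
      have s: "0 \<le> s" "s \<le> 1" "s * norm (X n - Y) = e"
        using ge e less_le_trans[OF e ge] by (simp_all add: s_def divide_le_eq_1)
      have "Y + s *\<^sub>R (X n - Y) \<in> sphere Y e" using s by (simp add: dist_norm)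
      from Z(2)[OF this] gap_mono_ray[OF s(1,2), of Y "X n"] elim show False by simp
    qed
  qed
  then show "\<exists>N. \<forall>n\<ge>N. dist (X n) Y < e" by (simp add: eventually_sequentially)
qed

end

text \<open>Eventually the sum is below l + e and the second summand is at least l - e, so the first
  is below 2e. Finiteness of \<open>l\<close> permits the subtraction. It serves both the gap
  integrals and the final Fatou argument.\<close>

lemma ennreal_add_tendsto_imp_tendsto_0:
  fixes f g :: "nat \<Rightarrow> ennreal"
  assumes "(\<lambda>n. f n + g n) \<longlonglongrightarrow> l" "l < \<infinity>" "l \<le> liminf g"
  shows "f \<longlonglongrightarrow> 0"
proof (rule order_tendstoI)
  fix a :: ennreal assume "0 < a"
  obtain i where i: "0 \<le> i" "l = ennreal i" using assms(2) by (cases l) auto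
  obtain e where e: "0 < e" "ennreal (2 * e) \<le> a"
  proof (cases a)
    case (real r)
    then show thesis using \<open>0 < a\<close> that[of "r / 2"] by auto
  next
    case top
    then show thesis using that[of 1] by simp
  qed
  have "l < ennreal (i + e)" using i e by (simp add: ennreal_less_iff)
  then have "\<forall>\<^sub>F n in sequentially. f n + g n < ennreal (i + e)" by (rule order_tendstoD[OF assms(1)])
  \<comment> \<open>If \<open>i \<le> e\<close> the lower bound is 0 and nothing has to be shown;
    otherwise it is strictly below the limit inferior.\<close>
  moreover have "\<forall>\<^sub>F n in sequentially. ennreal (i - e) \<le> g n"
  proof (cases "i \<le> e")
    case True
    then show ?thesis by (simp add: ennreal_neg)
  next
    case False
    then have "ennreal (i - e) < liminf g"
      using i e assms(3) by (intro less_le_trans[OF _ assms(3)]) (simp add: ennreal_less_iff)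
    then show ?thesis using less_LiminfD[of "ennreal (i - e)" sequentially g] by (auto elim: eventually_mono)
  qed
  ultimately show "\<forall>\<^sub>F n in sequentially. f n < a"
  proof eventually_elim
    case (elim n)
    then have "f n + g n < \<infinity>" by (metis ennreal_less_top infinity_ennreal_def less_trans)
    then obtain u v where uv: "0 \<le> u" "f n = ennreal u" "0 \<le> v" "g n = ennreal v"
      by (cases "f n"; cases "g n") auto
    have "u + v < i + e" using elim(1) uv i e by (simp add: ennreal_less_iff flip: ennreal_plus)
    moreover have "i - e \<le> v" using elim(2) uv by (simp add: ennreal_le_iff)
    ultimately have "f n < ennreal (2 * e)" using uv by (simp add: ennreal_less_iff)
    with e(2) show ?case by (rule less_le_trans[rotated])
  qed
qed simp

section \<open>Convergence of the energies of the half differences\<close>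

context strictly_convex_gauge
begin

lemma nn_integral_gauge_diff_tendsto_0:
  fixes \<Omega> :: "'a::euclidean_space set"
    and A :: "nat \<Rightarrow> 'a \<Rightarrow> 'b::euclidean_space"
  assumes wl: "weak_limit \<Omega> A B (\<lambda>X. \<phi> (norm X))"
    and conv: "(\<lambda>h. \<integral>\<^sup>+x\<in>\<Omega>. ennreal (\<phi> (norm (A h x))) \<partial>lebesgue)
      \<longlonglongrightarrow> (\<integral>\<^sup>+x\<in>\<Omega>. ennreal (\<phi> (norm (B x))) \<partial>lebesgue)"
    and fin: "(\<integral>\<^sup>+x\<in>\<Omega>. ennreal (\<phi> (norm (B x))) \<partial>lebesgue) < \<infinity>"
  shows "(\<lambda>h. \<integral>\<^sup>+x\<in>\<Omega>. ennreal (\<phi> (norm (A h x - B x) / 2)) \<partial>lebesgue) \<longlonglongrightarrow> 0"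
proof -
  interpret weak_limit \<Omega> A B "\<lambda>X. \<phi> (norm X)" by (rule wl)
  let ?N = "\<lambda>X :: 'b. \<phi> (norm X)"
  have [measurable]: "?N \<in> borel_measurable borel"
    by (rule borel_measurable_continuous_onI[OF continuous_gauge])
  have [measurable]: "\<Omega> \<in> sets lebesgue" using open_domain by simp
  define I where "I = (\<integral>\<^sup>+x\<in>\<Omega>. ennreal (?N (B x)) \<partial>lebesgue)"
  define E where "E = (\<lambda>h. \<integral>\<^sup>+x\<in>\<Omega>. ennreal (?N (A h x)) \<partial>lebesgue)"
  define M where "M = (\<lambda>h. \<integral>\<^sup>+x\<in>\<Omega>. ennreal (?N ((1 / 2) *\<^sub>R (A h x + B x))) \<partial>lebesgue)"
  define G where "G = (\<lambda>h. \<integral>\<^sup>+x\<in>\<Omega>. ennreal (gap (A h x) (B x)) \<partial>lebesgue)"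
  define T where "T = (\<lambda>h. \<integral>\<^sup>+x\<in>\<Omega>. ennreal (?N ((1 / 2) *\<^sub>R (A h x - B x))) \<partial>lebesgue)"
  define H where "H = (\<lambda>h x. (?N (A h x) + ?N (B x)) / 2 - ?N ((1 / 2) *\<^sub>R (A h x - B x)))"
  have gap_m [measurable]: "(\<lambda>x. gap (A h x) (B x)) \<in> borel_measurable lebesgue" for h
    unfolding gap_def by measurable
  have H_m [measurable]: "H h \<in> borel_measurable lebesgue" for h
    unfolding H_def by measurable
  \<comment> \<open>\<open>H\<close> is the gap between \<open>A h x\<close> and the reflected point
    \<open>- B x\<close>, as \<Phi> is even.\<close>
  have H_nonneg: "0 \<le> H h x" for h x
    using gap_nonneg[of "A h x" "- B x"] by (simp add: gap_def H_def)
  have half: "(\<integral>\<^sup>+x\<in>\<Omega>. ennreal ((?N (A h x) + ?N (B x)) / 2) \<partial>lebesgue) = (E h + I) / 2" for h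
  proof -
    have "(\<integral>\<^sup>+x\<in>\<Omega>. ennreal ((?N (A h x) + ?N (B x)) / 2) \<partial>lebesgue)
        = (\<integral>\<^sup>+x. (ennreal (?N (A h x)) * indicator \<Omega> x + ennreal (?N (B x)) * indicator \<Omega> x) / 2 \<partial>lebesgue)"
      using nonneg by (intro nn_integral_cong)
        (simp add: indicator_def divide_ennreal[symmetric] flip: ennreal_plus)
    also have "\<dots> = (E h + I) / 2"
      by (simp add: E_def I_def nn_integral_divide nn_integral_add)
    finally show ?thesis .
  qed
  \<comment> \<open>This identity and \<open>HT\<close> are stated as sums, since \<open>E h\<close>
    may be infinite for some \<open>h\<close>.\<close>
  have GM: "G h + M h = (E h + I) / 2" for h
  proof -
    have "G h + M h = (\<integral>\<^sup>+x\<in>\<Omega>. ennreal (gap (A h x) (B x)) + ennreal (?N ((1 / 2) *\<^sub>R (A h x + B x))) \<partial>lebesgue)"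
      unfolding G_def M_def distrib_right by (rule nn_integral_add[symmetric]) measurable
    also have "\<dots> = (\<integral>\<^sup>+x\<in>\<Omega>. ennreal ((?N (A h x) + ?N (B x)) / 2) \<partial>lebesgue)"
      unfolding ennreal_plus[OF gap_nonneg nonneg, symmetric] by (simp only: gap_def diff_add_cancel)
    finally show ?thesis using half by simp
  qed
  have HT: "(\<integral>\<^sup>+x\<in>\<Omega>. ennreal (H h x) \<partial>lebesgue) + T h = (E h + I) / 2" for h
  proof -
    have "(\<integral>\<^sup>+x\<in>\<Omega>. ennreal (H h x) \<partial>lebesgue) + T h = (\<integral>\<^sup>+x\<in>\<Omega>. ennreal (H h x) + ennreal (?N ((1 / 2) *\<^sub>R (A h x - B x))) \<partial>lebesgue)"
      unfolding T_def distrib_right by (rule nn_integral_add[symmetric]) measurable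
    also have "\<dots> = (\<integral>\<^sup>+x\<in>\<Omega>. ennreal ((?N (A h x) + ?N (B x)) / 2) \<partial>lebesgue)"
      unfolding ennreal_plus[OF H_nonneg nonneg, symmetric] by (simp only: H_def diff_add_cancel)
    finally show ?thesis using half by simp
  qed
  have "(I + I) / 2 = I"
  proof -
    obtain i where "0 \<le> i" "I = ennreal i" using fin by (cases I) (auto simp: I_def)
    then show ?thesis by (simp add: divide_ennreal flip: ennreal_plus ennreal_numeral)
  qed
  moreover have "inverse (2::ennreal) < top"
    using inverse_ennreal[of 2] by (metis ennreal_less_top ennreal_numeral zero_le_numeral zero_less_numeral)
  ultimately have EI: "(\<lambda>h. (E h + I) / 2) \<longlonglongrightarrow> I"
    using ennreal_tendsto_cmult[OF _ tendsto_add[OF conv[folded E_def I_def] tendsto_const[of I]], of "inverse 2"]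
    by (simp add: divide_ennreal_def mult.commute[of _ "inverse 2"])
  have I_fin: "I < \<infinity>" using fin by (simp add: I_def)
  \<comment> \<open>The midpoints have the same weak limit \<open>B\<close>: their bump averages
    tend to the mean of the average of \<open>B\<close> with itself.\<close>
  have "weak_limit \<Omega> (\<lambda>h x. (1 / 2) *\<^sub>R (A h x + B x)) B ?N"
  proof
    fix h and K :: "'a set" assume K: "compact K" "K \<subseteq> \<Omega>"
    show "set_integrable lebesgue K (\<lambda>x. (1 / 2) *\<^sub>R (A h x + B x))"
      using A_integrable[OF K, of h] B_integrable[OF K]
      by (intro set_integrable_scaleR_right set_integral_add(1))
  next
    fix c :: 'a and r d :: real assume *: "0 < r" "0 < d" "cball c r \<subseteq> \<Omega>"
    have i: "integrable lebesgue (\<lambda>x. bump d c r x *\<^sub>R A h x)" "integrable lebesgue (\<lambda>x. bump d c r x *\<^sub>R B x)" for h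
      using * by (auto intro!: bump_scaleR_integrable A_integrable B_integrable)
    have eq: "(\<integral>x. bump d c r x *\<^sub>R ((1 / 2) *\<^sub>R (A h x + B x)) \<partial>lebesgue)
        = (1 / 2) *\<^sub>R ((\<integral>x. bump d c r x *\<^sub>R A h x \<partial>lebesgue) + (\<integral>x. bump d c r x *\<^sub>R B x \<partial>lebesgue))" for h
      unfolding Bochner_Integration.integral_add[OF i, symmetric] integral_scaleR_right[symmetric]
      by (simp add: scaleR_add_right mult.commute)
    have "(\<lambda>h. \<integral>x. bump d c r x *\<^sub>R ((1 / 2) *\<^sub>R (A h x + B x)) \<partial>lebesgue) \<longlonglongrightarrow>
        (1 / 2) *\<^sub>R ((\<integral>x. bump d c r x *\<^sub>R B x \<partial>lebesgue) + (\<integral>x. bump d c r x *\<^sub>R B x \<partial>lebesgue))"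
      unfolding eq by (intro tendsto_intros weak *)
    then show "(\<lambda>h. \<integral>x. bump d c r x *\<^sub>R ((1 / 2) *\<^sub>R (A h x + B x)) \<partial>lebesgue) \<longlonglongrightarrow> (\<integral>x. bump d c r x *\<^sub>R B x \<partial>lebesgue)"
      by (simp add: scaleR_half_double del: scaleR_scaleR)
  qed (use open_domain B_integrable subgradient continuous nonneg in \<open>auto\<close>)
  then interpret mid: weak_limit \<Omega> "\<lambda>h x. (1 / 2) *\<^sub>R (A h x + B x)" B ?N .
  have "I \<le> liminf M"
    using mid.lower_semicontinuity by (simp add: I_def M_def)
  then have G0: "G \<longlonglongrightarrow> 0"
    using EI I_fin by (intro ennreal_add_tendsto_imp_tendsto_0[of G M I]) (simp_all add: GM)
  have "T \<longlonglongrightarrow> 0"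
  \<comment> \<open>Pointwise convergence is available only along subsequences. So a subsequence on
    which \<open>T\<close> stays above \<open>a\<close> is fixed, and a further one on which
    \<open>T\<close> tends to 0 contradicts it.\<close>
  proof (rule ccontr)
    assume "\<not> T \<longlonglongrightarrow> 0"
    then obtain a where a: "0 < a" "\<not> (\<forall>\<^sub>F h in sequentially. T h < a)"
      by (auto simp: order_tendsto_iff)
    \<comment> \<open>Finite gap integrals make the functions \<open>?u n\<close> integrable, so
      that convergence in mean yields an almost everywhere convergent subsequence.\<close>
    have "\<forall>\<^sub>F h in sequentially. G h < \<infinity>" using order_tendstoD(2)[OF G0, of \<infinity>] by simp
    moreover have "\<exists>\<^sub>F h in sequentially. a \<le> T h"
      using a(2) by (simp add: frequently_def not_le)
    ultimately have "\<exists>\<^sub>F h in sequentially. a \<le> T h \<and> G h < \<infinity>"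
      by (rule frequently_eventually_frequently[rotated])
    then have "infinite {h. a \<le> T h \<and> G h < \<infinity>}"
      by (simp add: frequently_cofinite[symmetric] cofinite_eq_sequentially)
    from infinite_enumerate[OF this] obtain r :: "nat \<Rightarrow> nat" where r: "strict_mono r" "\<And>n. a \<le> T (r n)" "\<And>n. G (r n) < \<infinity>"
      by auto
    let ?u = "\<lambda>n x. indicator \<Omega> x * gap (A (r n) x) (B x)"
    have u_nonneg: "0 \<le> ?u n x" for n x by (intro mult_nonneg_nonneg gap_nonneg) simp
    have u_G: "(\<integral>\<^sup>+x. ennreal (?u n x) \<partial>lebesgue) = G (r n)" for n
      unfolding G_def by (intro nn_integral_cong) (simp split: split_indicator)
    have u_meas: "?u n \<in> borel_measurable lebesgue" for n by measurable
    have u_int: "integrable lebesgue (?u n)" for n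
      by (rule integrableI_nonneg[OF u_meas AE_I2[OF u_nonneg]]) (use r(3) u_G in \<open>simp only:\<close>)
    have "(\<integral>x. norm (?u n x) \<partial>lebesgue) = enn2real (G (r n))" for n
    proof -
      have "(\<integral>x. norm (?u n x) \<partial>lebesgue) = (\<integral>x. ?u n x \<partial>lebesgue)"
        by (intro Bochner_Integration.integral_cong refl) (simp only: real_norm_def abs_of_nonneg[OF u_nonneg])
      also have "\<dots> = enn2real (G (r n))"
        unfolding u_G[symmetric] by (rule integral_eq_nn_integral[OF u_meas AE_I2[OF u_nonneg]])
      finally show ?thesis .
    qed
    moreover have "(\<lambda>n. enn2real (G (r n))) \<longlonglongrightarrow> enn2real 0"
      using LIMSEQ_subseq_LIMSEQ[OF G0 r(1)] by (intro tendsto_enn2real) (simp_all add: o_def)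
    ultimately have "(\<lambda>n. \<integral>x. norm (?u n x) \<partial>lebesgue) \<longlonglongrightarrow> 0" by simp
    then have "\<exists>s. strict_mono s \<and> (AE x in lebesgue. (\<lambda>n. ?u (s n) x) \<longlonglongrightarrow> 0)"
      by (rule tendsto_L1_AE_subseq[where u = ?u, OF u_int])
    then obtain s :: "nat \<Rightarrow> nat" where s: "strict_mono s" 
      "AE x in lebesgue. (\<lambda>n. ?u (s n) x) \<longlonglongrightarrow> 0" by (elim exE conjE) (rule that)
    define q where "q = r \<circ> s"
    have q: "strict_mono q" using r(1) s(1) by (simp add: q_def strict_mono_o)
    have "AE x in lebesgue. (\<lambda>n. ennreal (H (q n) x) * indicator \<Omega> x) \<longlonglongrightarrow> ennreal (?N (B x)) * indicator \<Omega> x"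
    proof (rule AE_mp[OF s(2)], intro AE_I2 impI)
      fix x assume elim: "(\<lambda>n. ?u (s n) x) \<longlonglongrightarrow> 0"
      show "(\<lambda>n. ennreal (H (q n) x) * indicator \<Omega> x) \<longlonglongrightarrow> ennreal (?N (B x)) * indicator \<Omega> x"
      proof (cases "x \<in> \<Omega>")
        case True
        have "(\<lambda>n. gap (A (q n) x) (B x)) \<longlonglongrightarrow> 0"
          using elim True by (simp add: q_def)
        then have A: "(\<lambda>n. A (q n) x) \<longlonglongrightarrow> B x"
          by (rule gap_tendsto_0_imp_tendsto)
        have N: "(\<lambda>n. ?N (X n)) \<longlonglongrightarrow> ?N Y" if "X \<longlonglongrightarrow> Y" for X and Y :: 'b
          using continuous_on_tendsto_compose[OF continuous_gauge that] by simp
        have 1: "(\<lambda>n. ?N (A (q n) x)) \<longlonglongrightarrow> ?N (B x)" by (rule N[OF A])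
        have 2: "(\<lambda>n. ?N ((1 / 2) *\<^sub>R (A (q n) x - B x))) \<longlonglongrightarrow> ?N ((1 / 2) *\<^sub>R (B x - B x))"
          by (rule N[OF tendsto_scaleR[OF tendsto_const tendsto_diff[OF A tendsto_const]]])
        have "(\<lambda>n. H (q n) x) \<longlonglongrightarrow> (?N (B x) + ?N (B x)) / 2 - ?N ((1 / 2) *\<^sub>R (B x - B x))"
          unfolding H_def by (rule tendsto_diff[OF tendsto_divide[OF tendsto_add[OF 1 tendsto_const] tendsto_const] 2]) simp
        then have "(\<lambda>n. H (q n) x) \<longlonglongrightarrow> ?N (B x)" using zero by simp
        then show ?thesis using True by (simp add: tendsto_ennrealI)
      qed simp
    qed
    then have "AE x in lebesgue. ennreal (?N (B x)) * indicator \<Omega> x = liminf (\<lambda>n. ennreal (H (q n) x) * indicator \<Omega> x)"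
      by eventually_elim (simp add: lim_imp_Liminf)
    then have "I = (\<integral>\<^sup>+x. liminf (\<lambda>n. ennreal (H (q n) x) * indicator \<Omega> x) \<partial>lebesgue)"
      unfolding I_def by (rule nn_integral_cong_AE)
    also have "\<dots> \<le> liminf (\<lambda>n. \<integral>\<^sup>+x\<in>\<Omega>. ennreal (H (q n) x) \<partial>lebesgue)"
      by (rule nn_integral_liminf) measurable
    finally have "I \<le> liminf (\<lambda>n. \<integral>\<^sup>+x\<in>\<Omega>. ennreal (H (q n) x) \<partial>lebesgue)" .
    \<comment> \<open>The total tends to \<open>I\<close> while Fatou gives the \<open>H\<close>
      part at least \<open>I\<close> in the limit inferior, so nothing is left for
      \<open>T\<close>.\<close>
    moreover have "(\<lambda>n. T (q n) + (\<integral>\<^sup>+x\<in>\<Omega>. ennreal (H (q n) x) \<partial>lebesgue)) \<longlonglongrightarrow> I"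
      using LIMSEQ_subseq_LIMSEQ[OF EI q] by (simp add: o_def HT add.commute[of "T _"])
    ultimately have "(\<lambda>n. T (q n)) \<longlonglongrightarrow> 0"
      using I_fin by (intro ennreal_add_tendsto_imp_tendsto_0)
    then have "\<forall>\<^sub>F n in sequentially. T (q n) < a" using a(1) by (rule order_tendstoD)
    then obtain n where "T (q n) < a" by (auto simp: eventually_sequentially)
    then show False using r(2)[of "s n"] by (simp add: q_def)
  qed
  then show ?thesis by (simp add: T_def)
qed

end

section \<open>Weak derivatives\<close>

text \<open>\<open>L1_loc\<close> speaks only of compact subsets, so measurability is obtained as a
  pointwise limit over a compact exhaustion. The indicator discards the arbitrary values outside
  \<open>U\<close>.\<close>

lemma L1_loc_measurable:
  fixes U :: "(real^'n) set" and u :: "real^'n \<Rightarrow> 'b::euclidean_space"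
  assumes "open U" "u \<in> L1_loc U"
  shows "(\<lambda>x. indicator U x *\<^sub>R u x) \<in> borel_measurable lebesgue"
proof -
  obtain C :: "nat \<Rightarrow> (real^'n) set" where C: "\<And>n. compact (C n)" "\<And>n. C n \<subseteq> U" "\<And>n. C n \<subseteq> interior (C (Suc n))" "\<Union>(range C) = U"
    "\<And>K. \<lbrakk>compact K; K \<subseteq> U\<rbrakk> \<Longrightarrow> \<exists>N. \<forall>n\<ge>N. K \<subseteq> C n"
    by (rule open_Union_compact_subsets[OF assms(1)]) (rule that)
  have "(\<lambda>n. indicator (C n) x *\<^sub>R u x) \<longlonglongrightarrow> indicator U x *\<^sub>R u x" for x
  proof (cases "x \<in> U")
    case True
    then obtain N where "\<forall>n\<ge>N. {x} \<subseteq> C n" using C(5)[of "{x}"] by auto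
    then have "\<forall>\<^sub>F n in sequentially. indicator (C n) x *\<^sub>R u x = indicator U x *\<^sub>R u x"
      using True by (auto simp: eventually_sequentially intro!: exI[of _ N])
    then show ?thesis by (rule tendsto_eventually)
  next
    case False
    then have "x \<notin> C n" for n using C(2) by blast
    with False show ?thesis by simp
  qed
  moreover have "(\<lambda>x. indicator (C n) x *\<^sub>R u x) \<in> borel_measurable lebesgue" for n
  proof (rule borel_measurable_integrable)
    show "integrable lebesgue (\<lambda>x. indicator (C n) x *\<^sub>R u x)"
      using assms(2) C(1,2) by (simp add: L1_loc_def set_integrable_def)
  qed
  ultimately show ?thesis by (rule borel_measurable_LIMSEQ_metric[rotated])
qed

text \<open>The defining identity moves the derivative onto the bump. Its partial derivative is
  bounded and vanishes off a compact ball, so the difference is controlled by the L1 distance of the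
  functions there.\<close>

lemma weak_derivative_bump_tendsto:
  fixes b :: "real^'n \<Rightarrow> real^'m"
  assumes Db: "has_weak_derivative U b Db" and Dbh: "\<And>h. has_weak_derivative U (bh h) (Dbh h)"
    and conv: "tendsto_L1_loc U bh b"
    and *: "0 < d" "0 < r" "cball c r \<subseteq> U"
  shows "(\<lambda>h. LINT x:U|lebesgue. Dbh h x $ i $ j * bump d c r x)
    \<longlonglongrightarrow> (LINT x:U|lebesgue. Db x $ i $ j * bump d c r x)"
proof -
  let ?\<psi> = "bump d c r"
  define \<eta> where "\<eta> = partial_deriv j ?\<psi>"
  let ?K = "cball c r"
  have \<eta>: "bumpy d c r \<eta>" unfolding \<eta>_def by (rule bumpy_partial_deriv[OF bumpy_bump *(1)])
  have \<eta>_out: "\<eta> x = 0" if "x \<notin> ?K" for x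
    using bumpy_eq_0[OF \<eta> *(2), of x] that by auto
  have "bounded (\<eta> ` ?K)"
    by (intro compact_imp_bounded compact_continuous_image bumpy_continuous[OF \<eta> *(1)]) simp
  then obtain m where "\<forall>y\<in>\<eta> ` ?K. norm y \<le> m" unfolding bounded_iff by (elim exE)
  then have m: "\<bar>\<eta> x\<bar> \<le> m" if "x \<in> ?K" for x using that by simp
  have \<eta>_meas [measurable]: "\<eta> \<in> borel_measurable lebesgue"
    using continuous_imp_measurable_on_sets_lebesgue[OF bumpy_continuous[OF \<eta> *(1)], of UNIV]
    by (simp add: lebesgue_on_UNIV_eq)
  have K: "set_integrable lebesgue ?K u" if "u \<in> L1_loc U" for u :: "real^'n \<Rightarrow> real^'m"
    using that *(3) by (simp add: L1_loc_def)
  \<comment> \<open>Restricting to the compact ball is what makes local integrability and local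
    convergence applicable.\<close>
  have eq: "(LINT x:U|lebesgue. u x $ i * \<eta> x) = (LINT x:?K|lebesgue. u x $ i * \<eta> x)" for u :: "real^'n \<Rightarrow> real^'m"
    unfolding set_lebesgue_integral_def
    using \<eta>_out *(3) by (intro Bochner_Integration.integral_cong) (auto simp: indicator_def)
  have prod_int: "set_integrable lebesgue ?K (\<lambda>x. u x $ i * \<eta> x)" if "u \<in> L1_loc U" for u :: "real^'n \<Rightarrow> real^'m"
    unfolding set_integrable_def
  proof (rule Bochner_Integration.integrable_bound)
    have u: "integrable lebesgue (\<lambda>x. indicator ?K x *\<^sub>R u x)"
      using K[OF that] by (simp add: set_integrable_def)
    show "integrable lebesgue (\<lambda>x. m * norm (indicator ?K x *\<^sub>R u x))"
      using u by (intro integrable_mult_right integrable_norm)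
    have "(\<lambda>x. (indicator ?K x *\<^sub>R u x) $ i * \<eta> x) \<in> borel_measurable lebesgue"
      by (intro borel_measurable_times borel_measurable_integrable[OF integrable_bounded_linear[OF bounded_linear_vec_nth u]] \<eta>_meas)
    then show "(\<lambda>x. indicator ?K x *\<^sub>R (u x $ i * \<eta> x)) \<in> borel_measurable lebesgue"
      by (simp add: mult.assoc)
    have "norm (indicator ?K x *\<^sub>R (u x $ i * \<eta> x)) \<le> norm (m * norm (indicator ?K x *\<^sub>R u x))" for x
    proof (cases "x \<in> ?K")
      case True
      have "\<bar>\<eta> x\<bar> * \<bar>u x $ i\<bar> \<le> m * norm (u x)"
        using m[OF True] component_le_norm_cart by (intro mult_mono) (auto intro: order_trans[OF abs_ge_zero])
      also have "\<dots> \<le> \<bar>m * norm (u x)\<bar>" by simp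
      finally show ?thesis using True by (simp add: abs_mult mult.commute)
    qed simp
    then show "AE x in lebesgue. norm (indicator ?K x *\<^sub>R (u x $ i * \<eta> x)) \<le> norm (m * norm (indicator ?K x *\<^sub>R u x))"
      by simp
  qed
  have b: "b \<in> L1_loc U" "\<And>h. bh h \<in> L1_loc U"
    using Db Dbh by (auto simp: has_weak_derivative_def)
  have diff_int: "set_integrable lebesgue ?K (\<lambda>x. bh h x - b x)" for h
    using K[OF b(1)] K[OF b(2)] by (intro set_integral_diff(1))
  have bound: "norm ((LINT x:U|lebesgue. bh h x $ i * \<eta> x) - (LINT x:U|lebesgue. b x $ i * \<eta> x))
      \<le> m * (LINT x:?K|lebesgue. norm (bh h x - b x))" for h
  proof -
    have "(LINT x:U|lebesgue. bh h x $ i * \<eta> x) - (LINT x:U|lebesgue. b x $ i * \<eta> x)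
        = (LINT x:?K|lebesgue. bh h x $ i * \<eta> x - b x $ i * \<eta> x)"
      unfolding eq using set_integral_diff(2)[OF prod_int[OF b(2)] prod_int[OF b(1)]] by simp
    also have "norm \<dots> \<le> (LINT x:?K|lebesgue. norm (bh h x $ i * \<eta> x - b x $ i * \<eta> x))"
      by (intro set_integral_norm_bound set_integral_diff(1) prod_int b)
    also have "\<dots> \<le> (LINT x:?K|lebesgue. m * norm (bh h x - b x))"
    proof (rule set_integral_mono)
      show "set_integrable lebesgue ?K (\<lambda>x. norm (bh h x $ i * \<eta> x - b x $ i * \<eta> x))"
        by (intro set_integrable_norm set_integral_diff(1) prod_int b)
      show "set_integrable lebesgue ?K (\<lambda>x. m * norm (bh h x - b x))"
        by (intro set_integrable_mult_right set_integrable_norm diff_int)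
      show "norm (bh h x $ i * \<eta> x - b x $ i * \<eta> x) \<le> m * norm (bh h x - b x)" if "x \<in> ?K" for x
      proof -
        have "\<bar>\<eta> x\<bar> * \<bar>(bh h x - b x) $ i\<bar> \<le> m * norm (bh h x - b x)"
          using m[OF that] component_le_norm_cart[of "bh h x - b x" i] by (intro mult_mono) (auto intro: order_trans[OF abs_ge_zero])
        moreover have "bh h x $ i * \<eta> x - b x $ i * \<eta> x = \<eta> x * (bh h x - b x) $ i"
          by (simp add: algebra_simps)
        ultimately show ?thesis by (simp only: real_norm_def abs_mult)
      qed
    qed
    finally show ?thesis by simp
  qed
  have "(\<lambda>h. (LINT x:U|lebesgue. bh h x $ i * \<eta> x) - (LINT x:U|lebesgue. b x $ i * \<eta> x)) \<longlonglongrightarrow> 0"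
  proof (rule Lim_null_comparison[OF always_eventually[OF allI[OF bound]]])
    show "(\<lambda>h. m * (LINT x:?K|lebesgue. norm (bh h x - b x))) \<longlonglongrightarrow> 0"
      using conv *(3) by (intro tendsto_mult_right_zero) (simp add: tendsto_L1_loc_def)
  qed
  then have "(\<lambda>h. LINT x:U|lebesgue. bh h x $ i * \<eta> x) \<longlonglongrightarrow> (LINT x:U|lebesgue. b x $ i * \<eta> x)"
    by (rule LIM_zero_cancel)
  then have "(\<lambda>h. - (LINT x:U|lebesgue. bh h x $ i * \<eta> x)) \<longlonglongrightarrow> - (LINT x:U|lebesgue. b x $ i * \<eta> x)"
    by (rule tendsto_minus)
  moreover have wd: "(LINT x:U|lebesgue. D x $ i $ j * ?\<psi> x) = - (LINT x:U|lebesgue. u x $ i * \<eta> x)"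
    if "has_weak_derivative U u D" for u :: "real^'n \<Rightarrow> real^'m" and D
    using that bump_test_function[OF *] by (simp add: has_weak_derivative_def \<eta>_def)
  ultimately show ?thesis by (simp only: wd[OF Db] wd[OF Dbh])
qed

text \<open>Cutting the derivatives off by the indicator makes them measurable on the whole space
  and does not affect integrals over compact subsets of \<open>U\<close>; weak convergence is then
  checked entry by entry.\<close>

lemma weak_limit_weak_derivative:
  fixes b :: "real^'n \<Rightarrow> real^'m"
  assumes U: "open U"
    and Db: "has_weak_derivative U b Db" and Dbh: "\<And>h. has_weak_derivative U (bh h) (Dbh h)"
    and conv: "tendsto_L1_loc U bh b"
    and \<Phi>: "\<And>S. \<exists>p. \<forall>X. \<Phi> S + p \<bullet> (X - S) \<le> \<Phi> X" "continuous_on UNIV \<Phi>" "\<And>X. 0 \<le> \<Phi> X"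
  shows "weak_limit U (\<lambda>h x. indicator U x *\<^sub>R Dbh h x) (\<lambda>x. indicator U x *\<^sub>R Db x) \<Phi>"
proof -
  have L: "D \<in> L1_loc U" if "has_weak_derivative U u D" for u :: "real^'n \<Rightarrow> real^'m" and D
    using that by (simp add: has_weak_derivative_def)
  have meas: "(\<lambda>x. indicator U x *\<^sub>R D x) \<in> borel_measurable lebesgue"
    if "has_weak_derivative U u D" for u :: "real^'n \<Rightarrow> real^'m" and D
    by (rule L1_loc_measurable[OF U L[OF that]])
  have int: "set_integrable lebesgue K (\<lambda>x. indicator U x *\<^sub>R D x)"
    if "has_weak_derivative U u D" "compact K" "K \<subseteq> U" for u :: "real^'n \<Rightarrow> real^'m" and D K
  proof -
    have "set_integrable lebesgue K D" using L[OF that(1)] that by (simp add: L1_loc_def)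
    moreover have "indicator K x *\<^sub>R (indicator U x *\<^sub>R D x) = indicator K x *\<^sub>R D x" for x
      using that(3) by (auto simp: indicator_def)
    ultimately show ?thesis by (simp only: set_integrable_def)
  qed
  \<comment> \<open>Taking an entry is bounded linear, so it commutes with the matrix-valued
    integral.\<close>
  have comp: "(\<integral>x. bump d c r x *\<^sub>R (indicator U x *\<^sub>R D x) \<partial>lebesgue) $ i $ j = (LINT x:U|lebesgue. D x $ i $ j * bump d c r x)"
    if "has_weak_derivative U u D" "0 < d" "0 < r" "cball c r \<subseteq> U" for u :: "real^'n \<Rightarrow> real^'m" and D c r d i j
  proof -
    let ?f = "\<lambda>x. bump d c r x *\<^sub>R (indicator U x *\<^sub>R D x)"
    have f: "integrable lebesgue ?f"
      using that by (intro bump_scaleR_integrable meas[OF that(1)] int[OF that(1)]) auto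
    have "bounded_linear (\<lambda>M :: real^'n^'m. M $ i $ j)"
      using bounded_linear_compose[OF bounded_linear_vec_nth[of j] bounded_linear_vec_nth[of i]] by (simp add: o_def)
    from integral_bounded_linear[OF this f] show ?thesis
      by (simp add: set_lebesgue_integral_def mult_ac)
  qed
  show ?thesis
  proof
    fix c and r d :: real assume *: "0 < r" "0 < d" "cball c r \<subseteq> U"
    show "(\<lambda>h. \<integral>x. bump d c r x *\<^sub>R (indicator U x *\<^sub>R Dbh h x) \<partial>lebesgue)
        \<longlonglongrightarrow> (\<integral>x. bump d c r x *\<^sub>R (indicator U x *\<^sub>R Db x) \<partial>lebesgue)"
      using weak_derivative_bump_tendsto[OF Db Dbh conv *(2,1,3)]
      by (intro vec_tendstoI) (simp only: comp[OF Db *(2,1,3)] comp[OF Dbh *(2,1,3)])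
  qed (use U meas[OF Db] meas[OF Dbh] int[OF Db] int[OF Dbh] \<Phi> in auto)
qed

theorem theorem4:
  fixes \<Omega> :: "(real^'n) set"
    and \<phi> :: "real \<Rightarrow> real"
    and b :: "real^'n \<Rightarrow> real^'m"
    and bh :: "nat \<Rightarrow> real^'n \<Rightarrow> real^'m"
    and Db :: "real^'n \<Rightarrow> real^'n^'m"
    and Dbh :: "nat \<Rightarrow> real^'n \<Rightarrow> real^'n^'m"
  assumes "open \<Omega>"
    and "\<forall>t\<ge>0. 0 \<le> \<phi> t"
    and "strictly_convex_on {0..} \<phi>"
    and "\<phi> 0 = 0"
    and "b \<in> W11_loc \<Omega>"
    and "\<forall>h. bh h \<in> W11_loc \<Omega>"
    and "has_weak_derivative \<Omega> b Db"
    and "\<forall>h. has_weak_derivative \<Omega> (bh h) (Dbh h)"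
    and "tendsto_L1_loc \<Omega> bh b"
    and "(\<lambda>h. \<integral>\<^sup>+x\<in>\<Omega>. ennreal (\<phi> (norm (Dbh h x))) \<partial>lebesgue)
           \<longlonglongrightarrow> (\<integral>\<^sup>+x\<in>\<Omega>. ennreal (\<phi> (norm (Db x))) \<partial>lebesgue)"
    and "(\<integral>\<^sup>+x\<in>\<Omega>. ennreal (\<phi> (norm (Db x))) \<partial>lebesgue) < \<infinity>"
  shows "(\<lambda>h. \<integral>\<^sup>+x\<in>\<Omega>. ennreal (\<phi> (norm (Dbh h x - Db x) / 2)) \<partial>lebesgue)
           \<longlonglongrightarrow> 0"
proof -
  interpret strictly_convex_gauge \<phi>
    using assms(2-4) by unfold_locales auto
  \<comment> \<open>The derivatives are arbitrary, possibly non-measurable, outside \<open>\<Omega>\<close>.\<close>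
  let ?A = "\<lambda>h x. indicator \<Omega> x *\<^sub>R Dbh h x" and ?B = "\<lambda>x. indicator \<Omega> x *\<^sub>R Db x"
  have wl: "weak_limit \<Omega> ?A ?B (\<lambda>X. \<phi> (norm X))"
    using assms(1,7-9) nonneg
    by (intro weak_limit_weak_derivative[of \<Omega> b Db bh Dbh] subgradient_gauge continuous_gauge) auto
  have eq: "(\<integral>\<^sup>+x\<in>\<Omega>. ennreal (\<phi> (norm (Dbh h x))) \<partial>lebesgue) = (\<integral>\<^sup>+x\<in>\<Omega>. ennreal (\<phi> (norm (?A h x))) \<partial>lebesgue)"
    "(\<integral>\<^sup>+x\<in>\<Omega>. ennreal (\<phi> (norm (Db x))) \<partial>lebesgue) = (\<integral>\<^sup>+x\<in>\<Omega>. ennreal (\<phi> (norm (?B x))) \<partial>lebesgue)"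
    "(\<integral>\<^sup>+x\<in>\<Omega>. ennreal (\<phi> (norm (Dbh h x - Db x) / 2)) \<partial>lebesgue)
      = (\<integral>\<^sup>+x\<in>\<Omega>. ennreal (\<phi> (norm (?A h x - ?B x) / 2)) \<partial>lebesgue)" for h
    by (intro nn_integral_cong; simp split: split_indicator)+
  show ?thesis
    using assms(10,11) unfolding eq by (rule nn_integral_gauge_diff_tendsto_0[OF wl])
qed

end
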